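(* Let $m\ge2$, let $H$ be a complex Hilbert space, and let $E$ be a POVM on $\Omega_m=\{0,\dots,m-1\}^{\mathbb N}$ with values in $B(H)$. Let $K_E$ be the direct limit Hilbert space of the range space system of $E$, let $P:\mathcal B(\Omega_m)\to B(K_E)$ be its canonical projection-valued measure, and let $V=U_0:H\to K_E$ be the canonical isometry. Then $(K_E,P,V)$ is a minimal Naimark dilation of $E$; that is, $$E(B)=V^*P(B)V,\qquad B\in\mathcal B(\Omega_m),$$ and $$K_E=\overline{\operatorname{span}}\{P(B)Vh:B\in\mathcal B(\Omega_m),\ h\in H\}.$$
   Context: $\Omega_m$ carries its product Borel $\sigma$-algebra $\mathcal B(\Omega_m)$. For a finite word $w=w_1\cdots w_n$ in $\{0,\dots,m-1\}$, $|w|=n$ and $[w]=\{x\in\Omega_m:x_1=w_1,\dots,x_n=w_n\}$; the empty word is $\varnothing$, and $[\varnothing]=\Omega_m$; $wj$ is $w$ with the letter $j$ appended. A POVM on $\Omega_m$ with values in $B(H)$ is a map $E:\mathcal B(\Omega_m)\to B(H)_+$ that is countably additive in the weak operator topology and satisfies $E(\Omega_m)=I$; it is a projection-valued measure (PVM) if all its values are orthogonal projections. Put $E_w=E([w])$ and $H_w=\overline{\operatorname{ran}}(E_w^{1/2})$. For $0\le j\le m-1$, the edge contraction $C_{wj}:H_w\to H_{wj}$ is the unique contraction with $C_{wj}E_w^{1/2}h=E_{wj}^{1/2}h$ for all $h\in H$. Set $K_n=\bigoplus_{|w|=n}H_w$ (so $K_0=H$), and let $J_n:K_n\to K_{n+1}$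 be given by $(J_nx)_{wj}=C_{wj}x_w$ for $|w|=n$, $0\le j\le m-1$; each $J_n$ is an isometry. $K_E$ is the Hilbert space direct limit of $K_0\xrightarrow{J_0}K_1\xrightarrow{J_1}K_2\to\cdots$, with canonical isometries $U_n:K_n\to K_E$ satisfying $U_{n+1}J_n=U_n$ and $K_E=\overline{\bigcup_{n\ge0}U_nK_n}$. For $n\ge|w|$, $P_w^{(n)}$ is the orthogonal projection of $K_n$ onto $\bigoplus_{|u|=n,\,u\succeq w}H_u$, where $u\succeq w$ means $u$ extends $w$. $P$ is the unique PVM on $\Omega_m$ with values in $B(K_E)$ such that $P([w])U_n=U_nP_w^{(n)}$ for every finite word $w$ and every $n\ge|w|$. *)

theory Defs
  imports "HOL-Analysis.Analysis" "HOL-Library.Sublist"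
begin

section \<open>Complex Hilbert spaces\<close>

text \<open>The real structure underlying a complex inner product space is the library's
  \<open>real_inner\<close>, so norm, topology and completeness are inherited from there. The complex inner
  product is linear in its first argument; its positivity follows from \<open>inner_eq_Re_cinner\<close>.\<close>

class complex_inner = real_inner +
  fixes scaleC :: "complex \<Rightarrow> 'a \<Rightarrow> 'a" (infixr "*\<^sub>C" 75)
    and cinner :: "'a \<Rightarrow> 'a \<Rightarrow> complex"
  assumes scaleC_add_right: "c *\<^sub>C (x + y) = c *\<^sub>C x + c *\<^sub>C y"
    and scaleC_add_left: "(c + d) *\<^sub>C x = c *\<^sub>C x + d *\<^sub>C x"
    and scaleC_scaleC: "c *\<^sub>C d *\<^sub>C x = (c * d) *\<^sub>C x"
    and scaleR_scaleC: "r *\<^sub>R x = complex_of_real r *\<^sub>C x"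
    and cinner_add_left: "cinner (x + y) z = cinner x z + cinner y z"
    and cinner_scaleC_left: "cinner (c *\<^sub>C x) y = c * cinner x y"
    and cinner_commute: "cinner x y = cnj (cinner y x)"
    and inner_eq_Re_cinner: "inner x y = Re (cinner x y)"

class chilbert_space = complex_inner + complete_space

instantiation complex :: chilbert_space
begin

definition scaleC_complex :: "complex \<Rightarrow> complex \<Rightarrow> complex"
  where "scaleC_complex c x = c * x"

definition cinner_complex :: "complex \<Rightarrow> complex \<Rightarrow> complex"
  where "cinner_complex x y = x * cnj y"

instance
  by standard
    (auto simp: scaleC_complex_def cinner_complex_def algebra_simps inner_complex_def
      scaleR_conv_of_real)

end

lemma vector_space_scaleC: "vector_space (scaleC :: complex \<Rightarrow> 'a \<Rightarrow> 'a::complex_inner)"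
proof
  show "1 *\<^sub>C x = x" for x :: 'a
    using scaleR_scaleC[of 1 x] by simp
qed (simp_all add: scaleC_add_right scaleC_add_left scaleC_scaleC)

definition cspan :: "'a::complex_inner set \<Rightarrow> 'a set"
  where "cspan = module.span scaleC"

definition clinear :: "('a::complex_inner \<Rightarrow> 'b::complex_inner) \<Rightarrow> bool"
  where "clinear = Vector_Spaces.linear scaleC scaleC"

definition bounded_clinear :: "('a::complex_inner \<Rightarrow> 'b::complex_inner) \<Rightarrow> bool"
  where "bounded_clinear T \<longleftrightarrow> clinear T \<and> (\<exists>M. \<forall>x. norm (T x) \<le> M * norm x)"

definition cisometry :: "('a::complex_inner \<Rightarrow> 'b::complex_inner) \<Rightarrow> bool"
  where "cisometry V \<longleftrightarrow> clinear V \<and> (\<forall>x. norm (V x) = norm x)"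

definition cadjoint :: "('a::complex_inner \<Rightarrow> 'b::complex_inner) \<Rightarrow> 'b \<Rightarrow> 'a"
  where "cadjoint T = (THE S. \<forall>x y. cinner (T x) y = cinner x (S y))"

definition positive_op :: "('a::complex_inner \<Rightarrow> 'a) \<Rightarrow> bool"
  where "positive_op T \<longleftrightarrow>
    bounded_clinear T \<and> (\<forall>x. cinner (T x) x \<in> \<real> \<and> 0 \<le> Re (cinner (T x) x))"

definition op_sqrt :: "('a::complex_inner \<Rightarrow> 'a) \<Rightarrow> 'a \<Rightarrow> 'a"
  where "op_sqrt T = (THE S. positive_op S \<and> S \<circ> S = T)"

definition orth_projection :: "('a::complex_inner \<Rightarrow> 'a) \<Rightarrow> bool"
  where "orth_projection Q \<longleftrightarrow>
    bounded_clinear Q \<and> Q \<circ> Q = Q \<and> (\<forall>x y. cinner (Q x) y = cinner x (Q y))"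


section \<open>The sequence space and operator-valued measures on it\<close>

definition Omega :: "nat \<Rightarrow> (nat \<Rightarrow> nat) measure"
  where "Omega m = (\<Pi>\<^sub>M i\<in>UNIV. count_space {..<m})"

definition words :: "nat \<Rightarrow> nat \<Rightarrow> nat list set"
  where "words m n = {w. length w = n \<and> set w \<subseteq> {..<m}}"

text \<open>Coordinates of sequences are numbered from 0 here, like list positions.\<close>

definition cyl :: "nat \<Rightarrow> nat list \<Rightarrow> (nat \<Rightarrow> nat) set"
  where "cyl m w = {x \<in> space (Omega m). \<forall>i<length w. x i = w ! i}"

text \<open>Operator-valued set functions are total on sets of sequences; only their values on
  \<open>sets (Omega m)\<close> are constrained.\<close>

definition is_povm :: "nat \<Rightarrow> ((nat \<Rightarrow> nat) set \<Rightarrow> 'a::complex_inner \<Rightarrow> 'a) \<Rightarrow> bool"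
  where "is_povm m E \<longleftrightarrow>
    (\<forall>B\<in>sets (Omega m). positive_op (E B)) \<and>
    (\<forall>A. range A \<subseteq> sets (Omega m) \<longrightarrow> disjoint_family A \<longrightarrow>
      (\<forall>x y. (\<lambda>i::nat. cinner (E (A i) x) y) sums cinner (E (\<Union>i. A i) x) y)) \<and>
    E (space (Omega m)) = id"

definition is_pvm :: "nat \<Rightarrow> ((nat \<Rightarrow> nat) set \<Rightarrow> 'a::complex_inner \<Rightarrow> 'a) \<Rightarrow> bool"
  where "is_pvm m P \<longleftrightarrow> is_povm m P \<and> (\<forall>B\<in>sets (Omega m). orth_projection (P B))"

definition minimal_naimark_dilation ::
  "nat \<Rightarrow> ((nat \<Rightarrow> nat) set \<Rightarrow> 'h::chilbert_space \<Rightarrow> 'h) \<Rightarrow>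
    ((nat \<Rightarrow> nat) set \<Rightarrow> 'k::chilbert_space \<Rightarrow> 'k) \<Rightarrow> ('h \<Rightarrow> 'k) \<Rightarrow> bool"
  where "minimal_naimark_dilation m E P V \<longleftrightarrow>
    is_pvm m P \<and> cisometry V \<and>
    (\<forall>B\<in>sets (Omega m). E B = cadjoint V \<circ> P B \<circ> V) \<and>
    closure (cspan {P B (V h) | B h. B \<in> sets (Omega m)}) = UNIV"


section \<open>The range space system of a POVM\<close>

definition range_space ::
  "nat \<Rightarrow> ((nat \<Rightarrow> nat) set \<Rightarrow> 'h::chilbert_space \<Rightarrow> 'h) \<Rightarrow> nat list \<Rightarrow> 'h set"
  where "range_space m E w = closure (range (op_sqrt (E (cyl m w))))"

text \<open>The edge contraction has domain \<open>range_space m E w\<close>; the extensional function space makes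
  it unique as a function on the whole type.\<close>

definition edge_contraction ::
  "nat \<Rightarrow> ((nat \<Rightarrow> nat) set \<Rightarrow> 'h::chilbert_space \<Rightarrow> 'h) \<Rightarrow> nat list \<Rightarrow> nat \<Rightarrow> 'h \<Rightarrow> 'h"
  where "edge_contraction m E w j = (THE C.
    C \<in> range_space m E w \<rightarrow>\<^sub>E range_space m E (w @ [j]) \<and>
    (\<forall>x\<in>range_space m E w. \<forall>y\<in>range_space m E w. C (x + y) = C x + C y) \<and>
    (\<forall>c. \<forall>x\<in>range_space m E w. C (c *\<^sub>C x) = c *\<^sub>C C x) \<and>
    (\<forall>x\<in>range_space m E w. norm (C x) \<le> norm x) \<and>
    (\<forall>h. C (op_sqrt (E (cyl m w)) h) = op_sqrt (E (cyl m (w @ [j]))) h))"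

text \<open>An element of the direct sum over the words of length \<open>n\<close> is a family indexed by all
  words that vanishes off \<open>words m n\<close>. Addition and scaling are pointwise, and the inner product
  is \<open>dsum_inner\<close>.\<close>

definition level_space ::
  "nat \<Rightarrow> ((nat \<Rightarrow> nat) set \<Rightarrow> 'h::chilbert_space \<Rightarrow> 'h) \<Rightarrow> nat \<Rightarrow> (nat list \<Rightarrow> 'h) set"
  where "level_space m E n =
    {x. (\<forall>w\<in>words m n. x w \<in> range_space m E w) \<and> (\<forall>w. w \<notin> words m n \<longrightarrow> x w = 0)}"

definition dsum_inner ::
  "nat \<Rightarrow> nat \<Rightarrow> (nat list \<Rightarrow> 'h::complex_inner) \<Rightarrow> (nat list \<Rightarrow> 'h) \<Rightarrow> complex"
  where "dsum_inner m n x y = (\<Sum>w\<in>words m n. cinner (x w) (y w))"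

definition level_map ::
  "nat \<Rightarrow> ((nat \<Rightarrow> nat) set \<Rightarrow> 'h::chilbert_space \<Rightarrow> 'h) \<Rightarrow> nat \<Rightarrow>
    (nat list \<Rightarrow> 'h) \<Rightarrow> nat list \<Rightarrow> 'h"
  where "level_map m E n x = (\<lambda>u. if u \<in> words m (Suc n)
    then edge_contraction m E (butlast u) (last u) (x (butlast u)) else 0)"

definition level_subspace ::
  "nat \<Rightarrow> ((nat \<Rightarrow> nat) set \<Rightarrow> 'h::chilbert_space \<Rightarrow> 'h) \<Rightarrow> nat \<Rightarrow> nat list \<Rightarrow>
    (nat list \<Rightarrow> 'h) set"
  where "level_subspace m E n w = {x \<in> level_space m E n. \<forall>u. \<not> prefix w u \<longrightarrow> x u = 0}"

definition level_proj ::
  "nat \<Rightarrow> ((nat \<Rightarrow> nat) set \<Rightarrow> 'h::chilbert_space \<Rightarrow> 'h) \<Rightarrow> nat \<Rightarrow> nat list \<Rightarrow>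
    (nat list \<Rightarrow> 'h) \<Rightarrow> nat list \<Rightarrow> 'h"
  where "level_proj m E n w x = (THE y. y \<in> level_subspace m E n w \<and>
    (\<forall>z\<in>level_subspace m E n w. dsum_inner m n (\<lambda>u. x u - y u) z = 0))"

text \<open>Hilbert space direct limits are determined up to unitary equivalence by the following
  properties, so a direct limit is a Hilbert space \<open>'k\<close> together with maps \<open>U n\<close> having them.
  Only the values of \<open>U n\<close> on \<open>level_space m E n\<close> matter.\<close>

definition is_direct_limit ::
  "nat \<Rightarrow> ((nat \<Rightarrow> nat) set \<Rightarrow> 'h::chilbert_space \<Rightarrow> 'h) \<Rightarrow>
    (nat \<Rightarrow> (nat list \<Rightarrow> 'h) \<Rightarrow> 'k::chilbert_space) \<Rightarrow> bool"
  where "is_direct_limit m E U \<longleftrightarrow>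
    (\<forall>n. \<forall>x\<in>level_space m E n. \<forall>y\<in>level_space m E n. U n (\<lambda>w. x w + y w) = U n x + U n y) \<and>
    (\<forall>n c. \<forall>x\<in>level_space m E n. U n (\<lambda>w. c *\<^sub>C x w) = c *\<^sub>C U n x) \<and>
    (\<forall>n. \<forall>x\<in>level_space m E n. \<forall>y\<in>level_space m E n. cinner (U n x) (U n y) = dsum_inner m n x y) \<and>
    (\<forall>n. \<forall>x\<in>level_space m E n. U (Suc n) (level_map m E n x) = U n x) \<and>
    closure (\<Union>n. U n ` level_space m E n) = UNIV"

definition is_canonical_pvm ::
  "nat \<Rightarrow> ((nat \<Rightarrow> nat) set \<Rightarrow> 'h::chilbert_space \<Rightarrow> 'h) \<Rightarrow>
    (nat \<Rightarrow> (nat list \<Rightarrow> 'h) \<Rightarrow> 'k::chilbert_space) \<Rightarrow>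
    ((nat \<Rightarrow> nat) set \<Rightarrow> 'k \<Rightarrow> 'k) \<Rightarrow> bool"
  where "is_canonical_pvm m E U P \<longleftrightarrow> is_pvm m P \<and>
    (\<forall>w n. set w \<subseteq> {..<m} \<longrightarrow> length w \<le> n \<longrightarrow>
      (\<forall>x\<in>level_space m E n. P (cyl m w) (U n x) = U n (level_proj m E n w x)))"

text \<open>\<open>U 0\<close> composed with the identification of \<open>'h\<close> with the direct sum over the empty word.\<close>

definition canonical_isometry ::
  "(nat \<Rightarrow> (nat list \<Rightarrow> 'h::chilbert_space) \<Rightarrow> 'k::chilbert_space) \<Rightarrow> 'h \<Rightarrow> 'k"
  where "canonical_isometry U h = U 0 (\<lambda>w. if w = [] then h else 0)"

end

theory Submission
  imports Defs
begin

text \<open>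
  The isometry \<open>V\<close> puts a vector \<open>h\<close> at the empty word. Since \<open>C\<^sub>w\<^sub>j E\<^sub>w\<^bsup>1/2\<^esup> h = E\<^sub>w\<^sub>j\<^bsup>1/2\<^esup> h\<close>, the
  connecting maps send it at level \<open>n\<close> to the family \<open>(E\<^sub>w\<^bsup>1/2\<^esup> h)\<^sub>w\<close> over the words of length \<open>n\<close>
  (\<open>level_map_level_image\<close>). The projection \<open>P [w]\<close> with \<open>|w| = n\<close> keeps only the entry at \<open>w\<close>, so
  \<open>\<langle>P [w] V h, V k\<rangle> = \<langle>E\<^sub>w\<^bsup>1/2\<^esup> h, E\<^sub>w\<^bsup>1/2\<^esup> k\<rangle> = \<langle>E\<^sub>w h, k\<rangle>\<close>. Both sides are restrictions to cylinders of
  complex measures, and cylinders generate the Borel sets and are closed under intersection up to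
  the empty set, hence \<open>\<langle>P B V h, V k\<rangle> = \<langle>E B h, k\<rangle>\<close> for all \<open>B\<close> (\<open>povm_compression_eqI\<close>). The vectors
  \<open>P [w] V h\<close> are the vectors \<open>E\<^sub>w\<^bsup>1/2\<^esup> h\<close> placed at \<open>w\<close>; these are dense in \<open>H\<^sub>w\<close>, so that their closed
  span contains every \<open>U\<^sub>n K\<^sub>n\<close> and is the whole space (\<open>closed_csubspace_eq_UNIV\<close>).

  Square root, edge contraction, level projection and adjoint are definite descriptions, and each
  has to be shown to exist uniquely. For \<open>0 \<le> T \<le> 1\<close> the square root is \<open>1 - Y\<close>, where \<open>Y\<close> is the limit
  of the iteration \<open>Y \<mapsto> (1 - T + Y\<^sup>2) / 2\<close> (\<open>positive_sqrt_ex1\<close>). The edge contraction extends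
  \<open>E\<^sub>w\<^bsup>1/2\<^esup> h \<mapsto> E\<^sub>w\<^sub>j\<^bsup>1/2\<^esup> h\<close> by continuity (\<open>contraction_extension_ex1\<close>). The adjoint of \<open>V\<close> is obtained
  from the minimality of the dilation: the compression identity exhibits its values on the
  vectors \<open>P B V h\<close>, whose span is dense (\<open>cadjoint_eqI\<close>).
\<close>

section \<open>Complex inner product spaces\<close>

interpretation complex_module: vector_space "scaleC :: complex \<Rightarrow> 'a \<Rightarrow> 'a::complex_inner"
  by (rule vector_space_scaleC)

lemma cinner_add_right: "cinner x (y + z) = cinner x y + cinner x z"
  by (metis cinner_add_left cinner_commute complex_cnj_add)

lemma cinner_scaleC_right: "cinner x (c *\<^sub>C y) = cnj c * cinner x y"
  by (metis cinner_commute cinner_scaleC_left complex_cnj_mult)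

lemma cinner_self: "cinner x x = complex_of_real ((norm x)\<^sup>2)"
proof (rule complex_eqI)
  show "Re (cinner x x) = Re (complex_of_real ((norm x)\<^sup>2))"
    by (simp flip: inner_eq_Re_cinner add: power2_norm_eq_inner)
  show "Im (cinner x x) = Im (complex_of_real ((norm x)\<^sup>2))"
    using arg_cong[OF cinner_commute[of x x], of Im] by simp
qed

lemma cinner_self_eq_0_iff: "cinner x x = 0 \<longleftrightarrow> x = 0"
  by (simp add: cinner_self)

lemma norm_scaleC: "norm (c *\<^sub>C x) = cmod c * norm x"
proof -
  have "cinner (c *\<^sub>C x) (c *\<^sub>C x) = (c * cnj c) * cinner x x"
    by (simp add: cinner_scaleC_left cinner_scaleC_right)
  also have "\<dots> = complex_of_real ((cmod c * norm x)\<^sup>2)"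
    by (simp only: cinner_self of_real_mult power_mult_distrib complex_norm_square)
  finally have "(norm (c *\<^sub>C x))\<^sup>2 = (cmod c * norm x)\<^sup>2"
    by (simp only: cinner_self of_real_eq_iff)
  then show ?thesis
    by simp
qed

lemma cmod_cinner_le: "cmod (cinner x y) \<le> norm x * norm y"
proof (cases "cinner x y = 0")
  case False
  \<comment> \<open>Rotating \<open>x\<close> by a phase makes the complex inner product real and positive.\<close>
  define c where "c = cnj (cinner x y) / complex_of_real (cmod (cinner x y))"
  have "cmod c = 1"
    using False by (simp add: c_def norm_divide)
  have "c * cinner x y = complex_of_real (cmod (cinner x y))"
    using False by (simp add: c_def mult.commute[of "cnj _"] flip: complex_norm_square)
      (simp add: power2_eq_square)
  then have "cmod (cinner x y) = inner (c *\<^sub>C x) y"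
    by (simp add: inner_eq_Re_cinner cinner_scaleC_left)
  also have "\<dots> \<le> norm (c *\<^sub>C x) * norm y"
    by (rule norm_cauchy_schwarz)
  finally show ?thesis
    by (simp add: norm_scaleC \<open>cmod c = 1\<close>)
qed simp

lemma bounded_bilinear_cinner:
  "bounded_bilinear (cinner :: 'a::complex_inner \<Rightarrow> 'a \<Rightarrow> complex)"
proof
  show "\<exists>K. \<forall>a b. norm (cinner a (b::'a)) \<le> norm a * norm b * K"
    by (intro exI[of _ 1]) (simp add: cmod_cinner_le)
qed (simp_all add: cinner_add_left cinner_add_right scaleR_scaleC[where 'a = 'a] cinner_scaleC_left
    cinner_scaleC_right scaleR_conv_of_real)

lemma bounded_bilinear_scaleC:
  "bounded_bilinear (scaleC :: complex \<Rightarrow> 'a \<Rightarrow> 'a::complex_inner)"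
proof
  show "\<exists>K. \<forall>a b. norm (a *\<^sub>C (b::'a)) \<le> norm a * norm b * K"
    by (intro exI[of _ 1]) (simp add: norm_scaleC)
qed (simp_all add: scaleC_add_left scaleC_add_right scaleR_scaleC[where 'a = 'a] scaleC_scaleC
    scaleR_conv_of_real mult.commute)

interpretation cinner: bounded_bilinear "cinner :: 'a::complex_inner \<Rightarrow> 'a \<Rightarrow> complex"
  by (rule bounded_bilinear_cinner)

interpretation scaleC: bounded_bilinear "scaleC :: complex \<Rightarrow> 'a \<Rightarrow> 'a::complex_inner"
  by (rule bounded_bilinear_scaleC)

lemmas [simp] = cinner.zero_left cinner.zero_right

lemma cinner_right_ext:
  assumes "\<And>x. cinner x y = cinner x z"
  shows "y = z"
proof -
  have "cinner (y - z) (y - z) = 0"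
    using assms[of "y - z"] by (simp add: cinner.diff_right)
  then show ?thesis
    by (simp add: cinner_self_eq_0_iff)
qed

lemma Im_cinner: "Im (cinner x y) = inner x (\<i> *\<^sub>C y)"
  by (simp add: inner_eq_Re_cinner cinner_scaleC_right)

lemma clinear_iff:
  "clinear T \<longleftrightarrow> (\<forall>x y. T (x + y) = T x + T y) \<and> (\<forall>c x. T (c *\<^sub>C x) = c *\<^sub>C T x)"
  by (auto simp: clinear_def Vector_Spaces.linear_iff vector_space_scaleC)

lemma clinear_imp_linear: "clinear T \<Longrightarrow> linear T"
  by (auto simp: clinear_iff scaleR_scaleC intro!: linearI)

lemma bounded_clinear_imp_bounded_linear:
  assumes "bounded_clinear T"
  shows "bounded_linear T"
proof -
  obtain M where "\<And>x. norm (T x) \<le> M * norm x"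
    using assms by (auto simp: bounded_clinear_def)
  then show ?thesis
    using assms clinear_imp_linear[of T]
    by (intro bounded_linear_intro[of T M])
      (auto simp: bounded_clinear_def linear_add linear_scale mult.commute)
qed


section \<open>Positive operators and their square roots\<close>

text \<open>Over the complex field a real quadratic form forces symmetry, so positivity can be tested
  with the real inner product alone.\<close>

lemma positive_op_iff:
  "positive_op T \<longleftrightarrow> bounded_clinear T \<and> (\<forall>x y. inner (T x) y = inner x (T y)) \<and>
     (\<forall>x. 0 \<le> inner (T x) x)"
proof (intro iffI conjI allI)
  assume pos: "positive_op T"
  then show "bounded_clinear T" and "0 \<le> inner (T x) x" for x
    by (auto simp: positive_op_def inner_eq_Re_cinner)
  have lin: "T (u + v) = T u + T v" "T (c *\<^sub>C u) = c *\<^sub>C T u" for u v c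
    using pos by (auto simp: positive_op_def bounded_clinear_def clinear_iff)
  have real: "Im (cinner (T u) u) = 0" for u
    using pos by (auto simp: positive_op_def complex_is_Real_iff)
  show "inner (T x) y = inner x (T y)" for x y
  proof -
    have "Im (cinner (T (x + \<i> *\<^sub>C y)) (x + \<i> *\<^sub>C y)) = 0"
      by (rule real)
    then have "inner (T x) y = inner (T y) x"
      by (simp add: lin cinner_add_left cinner_add_right cinner_scaleC_left cinner_scaleC_right
          real inner_eq_Re_cinner)
    then show ?thesis
      by (simp add: inner_commute)
  qed
next
  assume pos: "bounded_clinear T \<and> (\<forall>x y. inner (T x) y = inner x (T y)) \<and>
     (\<forall>x. 0 \<le> inner (T x) x)"
  have "Im (cinner (T x) x) = 0" for x
  proof -
    have "inner (T x) (\<i> *\<^sub>C x) = inner x (T (\<i> *\<^sub>C x))"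
      using pos by blast
    also have "\<dots> = inner x (\<i> *\<^sub>C T x)"
      using pos by (simp add: bounded_clinear_def clinear_iff)
    finally have "Im (cinner (T x) x) = Im (cinner x (T x))"
      unfolding Im_cinner .
    then show ?thesis
      using arg_cong[OF cinner_commute[of x "T x"], of Im] by simp
  qed
  then show "positive_op T"
    using pos by (auto simp: positive_op_def complex_is_Real_iff simp flip: inner_eq_Re_cinner)
qed

lemma positive_op_cinner_commute:
  assumes "positive_op T"
  shows "cinner (T x) y = cinner x (T y)"
proof -
  have sym: "inner (T u) v = inner u (T v)" for u v
    using assms by (auto simp: positive_op_iff)
  have lin: "T (c *\<^sub>C u) = c *\<^sub>C T u" for c u
    using assms by (auto simp: positive_op_iff bounded_clinear_def clinear_iff)
  show ?thesis
  proof (rule complex_eqI)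
    show "Re (cinner (T x) y) = Re (cinner x (T y))"
      using sym by (simp add: inner_eq_Re_cinner)
    show "Im (cinner (T x) y) = Im (cinner x (T y))"
      unfolding Im_cinner by (simp only: sym flip: lin)
  qed
qed

lemma nonneg_quadratic_discriminant:
  fixes p q r :: real
  assumes nonneg: "\<And>t. 0 \<le> p + 2 * t * q + t\<^sup>2 * r" and "0 \<le> r"
  shows "q\<^sup>2 \<le> p * r"
proof (cases "r = 0")
  case True
  have "q = 0"
  proof (rule ccontr)
    assume "q \<noteq> 0"
    then show False
      using nonneg[of "- (p + 1) / (2 * q)"] True by (simp add: field_simps)
  qed
  then show ?thesis
    using True by simp
next
  case False
  with \<open>0 \<le> r\<close> have "r > 0"
    by simp
  then have "p + 2 * (- q / r) * q + (- q / r)\<^sup>2 * r = p - q\<^sup>2 / r"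
    by (simp add: power2_eq_square field_simps)
  then have "q\<^sup>2 / r \<le> p"
    using nonneg[of "- q / r"] by simp
  then show ?thesis
    using \<open>r > 0\<close> by (simp add: field_simps)
qed

lemma positive_op_Cauchy_Schwarz:
  assumes "positive_op T"
  shows "(inner (T x) y)\<^sup>2 \<le> inner (T x) x * inner (T y) y"
proof (rule nonneg_quadratic_discriminant)
  have lin: "linear T" and sym: "\<And>u v. inner (T u) v = inner u (T v)"
    and pos: "\<And>u. 0 \<le> inner (T u) u"
    using assms by (auto simp: positive_op_iff bounded_clinear_def clinear_imp_linear)
  have "inner (T y) x = inner (T x) y"
    by (metis sym inner_commute)
  then have "inner (T (x + t *\<^sub>R y)) (x + t *\<^sub>R y)
      = inner (T x) x + 2 * t * inner (T x) y + t\<^sup>2 * inner (T y) y" for t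
    by (simp add: linear_add[OF lin] linear_scale[OF lin] inner_add_left inner_add_right
        power2_eq_square algebra_simps)
  then show "0 \<le> inner (T x) x + 2 * t * inner (T x) y + t\<^sup>2 * inner (T y) y" for t
    using pos[of "x + t *\<^sub>R y"] by simp
  show "0 \<le> inner (T y) y"
    by (rule pos)
qed

lemma positive_op_eq_0:
  assumes "positive_op T" and "inner (T x) x = 0"
  shows "T x = 0"
  using positive_op_Cauchy_Schwarz[OF assms(1), of x "T x"] assms(2) by simp

lemma positive_op_contraction:
  assumes "positive_op T" and le: "\<And>x. inner (T x) x \<le> inner x x"
  shows "norm (T x) \<le> norm x"
proof (cases "T x = 0")
  case False
  have "(inner (T x) (T x))\<^sup>2 \<le> inner (T x) x * inner (T (T x)) (T x)"
    by (rule positive_op_Cauchy_Schwarz[OF assms(1)])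
  also have "\<dots> \<le> inner x x * inner (T x) (T x)"
    using assms(1) by (intro mult_mono le) (simp_all add: positive_op_def flip: inner_eq_Re_cinner)
  finally have "inner (T x) (T x) \<le> inner x x"
    using False by (simp add: power2_eq_square)
  then show ?thesis
    by (simp add: norm_le)
qed simp

text \<open>For a linear contraction \<open>A\<close> of a Hilbert space the iterates \<open>Y\<^sub>n\<^sub>+\<^sub>1 = (A + Y\<^sub>n\<^sup>2) / 2\<close>, started
  at \<open>0\<close>, converge pointwise to a solution of \<open>(1 - Y)\<^sup>2 = 1 - A\<close>.\<close>

primrec sqrt_iter :: "('a::real_vector \<Rightarrow> 'a) \<Rightarrow> nat \<Rightarrow> 'a \<Rightarrow> 'a" where
  "sqrt_iter A 0 x = 0"
| "sqrt_iter A (Suc n) x = (1/2) *\<^sub>R (A x + sqrt_iter A n (sqrt_iter A n x))"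

text \<open>The same iteration for the number \<open>1\<close> in place of \<open>A\<close>. It dominates the norms of the \<open>Y\<^sub>n\<close> and
  of their differences, and it converges by monotonicity.\<close>

primrec sqrt_bound :: "nat \<Rightarrow> real" where
  "sqrt_bound 0 = 0"
| "sqrt_bound (Suc n) = (1 + (sqrt_bound n)\<^sup>2) / 2"

lemma sqrt_bound_nonneg: "0 \<le> sqrt_bound n" and sqrt_bound_le_1: "sqrt_bound n \<le> 1"
proof -
  have "0 \<le> sqrt_bound n \<and> sqrt_bound n \<le> 1"
    by (induction n) (auto simp: power_le_one)
  then show "0 \<le> sqrt_bound n" "sqrt_bound n \<le> 1"
    by auto
qed

lemma sqrt_bound_mono: "sqrt_bound n \<le> sqrt_bound (Suc n)"
proof -
  have "0 \<le> (1 - sqrt_bound n)\<^sup>2"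
    by simp
  then show ?thesis
    by (simp add: power2_eq_square algebra_simps)
qed

lemma Cauchy_sqrt_bound: "Cauchy sqrt_bound"
proof (rule convergent_Cauchy, rule Bseq_mono_convergent)
  show "Bseq sqrt_bound"
    using sqrt_bound_nonneg sqrt_bound_le_1 by (intro BseqI'[of _ 1]) (simp add: abs_le_iff)
  show "\<forall>k n. k \<le> n \<longrightarrow> sqrt_bound k \<le> sqrt_bound n"
    using sqrt_bound_mono lift_Suc_mono_le by blast
qed

lemma sqrt_iter_linear:
  assumes "linear A"
  shows "linear (sqrt_iter A n)"
proof (induction n)
  case 0
  show ?case by (intro linearI) auto
next
  case (Suc n)
  then show ?case
    by (intro linearI)
      (simp_all add: linear_add[OF assms] linear_scale[OF assms] linear_add linear_scale
        algebra_simps)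
qed

text \<open>Taking \<open>R\<close> to be an iterate itself shows that the iterates commute with each other.\<close>

lemma sqrt_iter_commute:
  assumes "linear R" and "\<And>x. R (A x) = A (R x)"
  shows "R (sqrt_iter A n x) = sqrt_iter A n (R x)"
proof (induction n arbitrary: x)
  case 0
  show ?case by (simp add: linear_0[OF assms(1)])
next
  case (Suc n)
  then show ?case
    by (simp add: linear_add[OF assms(1)] linear_scale[OF assms(1)] assms(2))
qed

lemma sqrt_iter_norm_le:
  fixes A :: "'a::real_normed_vector \<Rightarrow> 'a"
  assumes "\<And>x. norm (A x) \<le> norm x"
  shows "norm (sqrt_iter A n x) \<le> sqrt_bound n * norm x"
proof (induction n arbitrary: x)
  case 0
  show ?case by simp
next
  case (Suc n)
  have "norm (sqrt_iter A n (sqrt_iter A n x)) \<le> sqrt_bound n * norm (sqrt_iter A n x)"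
    by (rule Suc)
  also have "\<dots> \<le> sqrt_bound n * (sqrt_bound n * norm x)"
    by (intro mult_left_mono Suc sqrt_bound_nonneg)
  finally have "norm (A x + sqrt_iter A n (sqrt_iter A n x))
      \<le> norm x + sqrt_bound n * (sqrt_bound n * norm x)"
    using assms[of x] norm_triangle_ineq[of "A x" "sqrt_iter A n (sqrt_iter A n x)"] by linarith
  then show ?case
    by (simp add: power2_eq_square algebra_simps del: scaleR_add_right)
qed

lemma sqrt_iter_contraction:
  fixes A :: "'a::real_normed_vector \<Rightarrow> 'a"
  assumes "\<And>x. norm (A x) \<le> norm x"
  shows "norm (sqrt_iter A n x) \<le> norm x"
  using sqrt_iter_norm_le[OF assms, of n x] mult_right_mono[OF sqrt_bound_le_1 norm_ge_zero, of n x]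
  by simp

lemma sqrt_iter_step_le:
  fixes A :: "'a::real_normed_vector \<Rightarrow> 'a"
  assumes lin: "linear A" and contr: "\<And>x. norm (A x) \<le> norm x"
  shows "norm (sqrt_iter A (Suc n) x - sqrt_iter A n x)
    \<le> (sqrt_bound (Suc n) - sqrt_bound n) * norm x"
proof (induction n arbitrary: x)
  case 0
  show ?case using contr[of x] by simp
next
  case (Suc n)
  let ?Y = "sqrt_iter A" and ?y = sqrt_bound
  define u where "u = ?Y (Suc n) x + ?Y n x"
  have Yadd: "?Y k (a + b) = ?Y k a + ?Y k b" for k a b
    by (rule linear_add[OF sqrt_iter_linear[OF lin]])
  have "A (?Y n z) = ?Y n (A z)" for z
    by (rule sqrt_iter_commute[OF lin]) simp
  then have comm: "?Y n (?Y (Suc n) z) = ?Y (Suc n) (?Y n z)" for z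
    by (intro sqrt_iter_commute sqrt_iter_linear lin) simp
  \<comment> \<open>The iterates commute, so the difference of squares factors.\<close>
  have "?Y (Suc (Suc n)) x - ?Y (Suc n) x
      = (1/2) *\<^sub>R (?Y (Suc n) (?Y (Suc n) x) - ?Y n (?Y n x))"
    by (simp only: sqrt_iter.simps(2)[of A "Suc n"] sqrt_iter.simps(2)[of A n x])
      (simp flip: scaleR_diff_right)
  also have "\<dots> = (1/2) *\<^sub>R (?Y (Suc n) u - ?Y n u)"
    unfolding u_def Yadd comm by simp
  finally have "norm (?Y (Suc (Suc n)) x - ?Y (Suc n) x) = norm (?Y (Suc n) u - ?Y n u) / 2"
    by simp
  also have "\<dots> \<le> (?y (Suc n) - ?y n) * norm u / 2"
    using Suc[of u] by (simp del: sqrt_iter.simps sqrt_bound.simps)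
  also have "norm u \<le> (?y (Suc n) + ?y n) * norm x"
    unfolding u_def
    using norm_triangle_ineq[of "?Y (Suc n) x" "?Y n x"]
      sqrt_iter_norm_le[OF contr, of "Suc n" x] sqrt_iter_norm_le[OF contr, of n x]
    by (simp only: distrib_right)
  then have "(?y (Suc n) - ?y n) * norm u / 2
      \<le> (?y (Suc n) - ?y n) * ((?y (Suc n) + ?y n) * norm x) / 2"
    using sqrt_bound_mono[of n]
    by (intro divide_right_mono mult_left_mono) (auto simp del: sqrt_bound.simps)
  also have "\<dots> = (?y (Suc (Suc n)) - ?y (Suc n)) * norm x"
    by (simp only: sqrt_bound.simps(2)[of "Suc n"] sqrt_bound.simps(2)[of n])
      (simp add: power2_eq_square field_simps)
  finally show ?case
    by simp
qed

lemma sqrt_iter_dist_le: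
  fixes A :: "'a::real_normed_vector \<Rightarrow> 'a"
  assumes lin: "linear A" and contr: "\<And>x. norm (A x) \<le> norm x" and "k \<le> n"
  shows "norm (sqrt_iter A n x - sqrt_iter A k x) \<le> (sqrt_bound n - sqrt_bound k) * norm x"
  using \<open>k \<le> n\<close>
proof (induction n rule: dec_induct)
  case base
  show ?case by simp
next
  case (step n)
  have "norm (sqrt_iter A (Suc n) x - sqrt_iter A k x)
      \<le> norm (sqrt_iter A (Suc n) x - sqrt_iter A n x) + norm (sqrt_iter A n x - sqrt_iter A k x)"
    by (rule norm_diff_triangle_le) auto
  also have "\<dots> \<le> (sqrt_bound (Suc n) - sqrt_bound n) * norm x
      + (sqrt_bound n - sqrt_bound k) * norm x"
    by (intro add_mono sqrt_iter_step_le lin contr step.IH)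
  finally show ?case
    by (simp only: flip: distrib_right) simp
qed

lemma sqrt_iter_convergent:
  fixes A :: "'a::chilbert_space \<Rightarrow> 'a"
  assumes lin: "linear A" and contr: "\<And>x. norm (A x) \<le> norm x"
  shows "convergent (\<lambda>n. sqrt_iter A n x)"
proof (rule Cauchy_convergent, rule CauchyI)
  fix e :: real
  assume "e > 0"
  then have "e / (norm x + 1) > 0"
    by (simp add: add_nonneg_pos)
  from CauchyD[OF Cauchy_sqrt_bound this] obtain N where
    N: "\<And>k n. k \<ge> N \<Longrightarrow> n \<ge> N \<Longrightarrow> \<bar>sqrt_bound n - sqrt_bound k\<bar> < e / (norm x + 1)"
    by auto
  have "norm (sqrt_iter A n x - sqrt_iter A k x) < e" if "k \<ge> N" "n \<ge> N" "k \<le> n" for k n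
  proof -
    have "norm (sqrt_iter A n x - sqrt_iter A k x) \<le> (sqrt_bound n - sqrt_bound k) * norm x"
      by (rule sqrt_iter_dist_le[OF lin contr \<open>k \<le> n\<close>])
    also have "\<dots> \<le> e / (norm x + 1) * norm x"
      using N[of k n] that by (intro mult_right_mono) auto
    also have "\<dots> < e"
      using \<open>e > 0\<close> by (simp add: pos_divide_less_eq add_nonneg_pos)
    finally show ?thesis .
  qed
  then have "\<forall>k\<ge>N. \<forall>n\<ge>N. norm (sqrt_iter A k x - sqrt_iter A n x) < e"
    by (metis nle_le norm_minus_commute)
  then show "\<exists>N. \<forall>k\<ge>N. \<forall>n\<ge>N. norm (sqrt_iter A k x - sqrt_iter A n x) < e"
    by blast
qed

text \<open>The square root is a limit of polynomials in \<open>T\<close>, so it commutes with everything that commutes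
  with \<open>T\<close>; uniqueness below rests on this.\<close>

lemma positive_sqrt_exists:
  fixes T :: "'a::chilbert_space \<Rightarrow> 'a"
  assumes pos: "positive_op T" and le: "\<And>x. inner (T x) x \<le> inner x x"
  obtains S where "positive_op S" and "S \<circ> S = T"
    and "\<And>R x. bounded_clinear R \<Longrightarrow> (\<And>z. R (T z) = T (R z)) \<Longrightarrow> R (S x) = S (R x)"
proof -
  define A where "A x = x - T x" for x
  have Tlin: "clinear T" and Tsym: "\<And>x y. inner (T x) y = inner x (T y)"
    and Tpos: "\<And>x. 0 \<le> inner (T x) x"
    using pos by (auto simp: positive_op_iff bounded_clinear_def)
  have Abnd: "bounded_clinear A"
  proof -
    have "clinear A"
      using Tlin by (simp add: clinear_iff A_def scaleC.diff_right)
    moreover have "norm (A x) \<le> 2 * norm x" for x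
      using norm_triangle_ineq4[of x "T x"] positive_op_contraction[OF pos le, of x]
      by (simp add: A_def)
    ultimately show ?thesis
      by (auto simp: bounded_clinear_def)
  qed
  then have Alin: "linear A"
    by (simp add: bounded_clinear_def clinear_imp_linear)
  have Apos: "positive_op A"
    using Abnd le by (simp add: positive_op_iff A_def inner_diff_left inner_diff_right Tsym)
  have contr: "norm (A x) \<le> norm x" for x
    using Tpos by (intro positive_op_contraction[OF Apos]) (simp add: A_def inner_diff_left)
  let ?Y = "sqrt_iter A"
  define Y where "Y x = lim (\<lambda>n. ?Y n x)" for x
  have lim: "(\<lambda>n. ?Y n x) \<longlonglongrightarrow> Y x" for x
    using sqrt_iter_convergent[OF Alin contr] by (simp add: Y_def convergent_LIMSEQ_iff)
  have Yn_lin: "linear (?Y n)" for n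
    by (rule sqrt_iter_linear[OF Alin])
  have comm: "R (Y x) = Y (R x)" if R: "bounded_clinear R" and RA: "\<And>z. R (A z) = A (R z)" for R x
  proof -
    have "(\<lambda>n. R (?Y n x)) \<longlonglongrightarrow> R (Y x)"
      by (intro bounded_linear.tendsto[OF bounded_clinear_imp_bounded_linear[OF R]] lim)
    moreover have "R (?Y n x) = ?Y n (R x)" for n
      using R RA by (intro sqrt_iter_commute) (auto simp: bounded_clinear_def clinear_imp_linear)
    ultimately show ?thesis
      using LIMSEQ_unique[OF lim[of "R x"]] by simp
  qed
  have Yadd: "Y (x + y) = Y x + Y y" for x y
    using LIMSEQ_unique[OF lim[of "x + y"]] tendsto_add[OF lim[of x] lim[of y]]
    by (simp add: linear_add[OF Yn_lin])
  have YscaleC: "Y (c *\<^sub>C x) = c *\<^sub>C Y x" for c x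
  proof -
    have "c *\<^sub>C ?Y n x = ?Y n (c *\<^sub>C x)" for n
      using Abnd
      by (intro sqrt_iter_commute linearI)
        (auto simp: bounded_clinear_def clinear_iff scaleC_add_right scaleR_scaleC scaleC_scaleC
          mult.commute)
    then show ?thesis
      using LIMSEQ_unique[OF lim[of "c *\<^sub>C x"]] scaleC.tendsto[OF tendsto_const[of c] lim[of x]]
      by simp
  qed
  have Ycontr: "norm (Y x) \<le> norm x" for x
    by (rule Lim_bounded[OF tendsto_norm[OF lim[of x]], of 0])
      (simp add: sqrt_iter_contraction[OF contr])
  have Ysym: "inner (Y x) y = inner x (Y y)" for x y
  proof -
    have "inner (?Y n x) y = inner x (?Y n y)" for n x y
      using Apos
      by (induction n arbitrary: x y)
        (auto simp: positive_op_iff inner_add_left inner_add_right)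
    then show ?thesis
      using LIMSEQ_unique[OF tendsto_inner[OF lim[of x] tendsto_const[of y]]]
        tendsto_inner[OF tendsto_const[of x] lim[of y]]
      by simp
  qed
  have Yeq: "2 *\<^sub>R Y x = A x + Y (Y x)" for x
  proof -
    have "(\<lambda>n. ?Y n (?Y n x - Y x)) \<longlonglongrightarrow> 0"
    proof (rule Lim_null_comparison)
      show "\<forall>\<^sub>F n in sequentially. norm (?Y n (?Y n x - Y x)) \<le> norm (?Y n x - Y x)"
        by (simp add: sqrt_iter_contraction[OF contr])
      show "(\<lambda>n. norm (?Y n x - Y x)) \<longlonglongrightarrow> 0"
        using lim[of x] by (simp add: LIM_zero tendsto_norm_zero)
    qed
    then have "(\<lambda>n. ?Y n (?Y n x - Y x) + ?Y n (Y x)) \<longlonglongrightarrow> 0 + Y (Y x)"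
      by (intro tendsto_add lim)
    then have "(\<lambda>n. ?Y n (?Y n x)) \<longlonglongrightarrow> Y (Y x)"
      by (simp add: linear_diff[OF Yn_lin])
    then have "(\<lambda>n. ?Y (Suc n) x) \<longlonglongrightarrow> (1/2) *\<^sub>R (A x + Y (Y x))"
      by (simp only: sqrt_iter.simps) (intro tendsto_intros)
    moreover have "(\<lambda>n. ?Y (Suc n) x) \<longlonglongrightarrow> Y x"
      using lim[of x] by (rule LIMSEQ_Suc)
    ultimately have "Y x = (1/2) *\<^sub>R (A x + Y (Y x))"
      using LIMSEQ_unique by blast
    then have "2 *\<^sub>R Y x = 2 *\<^sub>R ((1/2) *\<^sub>R (A x + Y (Y x)))"
      by (rule arg_cong)
    then show ?thesis
      by simp
  qed
  define S where "S x = x - Y x" for x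
  have Ydiff: "Y (x - y) = Y x - Y y" for x y
    by (metis Yadd add_diff_cancel diff_add_cancel)
  have "positive_op S"
    unfolding positive_op_iff
  proof (intro conjI allI)
    have "norm (S x) \<le> 2 * norm x" for x
      using norm_triangle_ineq4[of x "Y x"] Ycontr[of x] by (simp add: S_def)
    then show "bounded_clinear S"
      by (auto simp: bounded_clinear_def clinear_iff S_def Yadd YscaleC scaleC.diff_right)
    show "inner (S x) y = inner x (S y)" for x y
      by (simp add: S_def inner_diff_left inner_diff_right Ysym)
    have "inner (Y x) x \<le> inner x x" for x
      using norm_cauchy_schwarz[of "Y x" x] mult_right_mono[OF Ycontr norm_ge_zero, of x x]
      by (simp add: power2_norm_eq_inner[symmetric] power2_eq_square)
    then show "0 \<le> inner (S x) x" for x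
      by (simp add: S_def inner_diff_left)
  qed
  moreover have "S \<circ> S = T"
  proof
    fix x
    have "S (S x) = x - 2 *\<^sub>R Y x + Y (Y x)"
      by (simp add: S_def Ydiff scaleR_2)
    then show "(S \<circ> S) x = T x"
      by (simp add: Yeq A_def)
  qed
  moreover have "R (S x) = S (R x)" if "bounded_clinear R" "\<And>z. R (T z) = T (R z)" for R x
  proof -
    have "linear R"
      using that(1) by (simp add: bounded_clinear_def clinear_imp_linear)
    then show ?thesis
      using comm[OF that(1)] that(2) by (simp add: S_def A_def linear_diff)
  qed
  ultimately show ?thesis
    using that by blast
qed

lemma positive_sqrt_ex1:
  fixes T :: "'a::chilbert_space \<Rightarrow> 'a"
  assumes pos: "positive_op T" and le: "\<And>x. inner (T x) x \<le> inner x x"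
  shows "\<exists>!S. positive_op S \<and> S \<circ> S = T"
proof -
  obtain S where S: "positive_op S" "S \<circ> S = T"
    and comm: "\<And>R x. bounded_clinear R \<Longrightarrow> (\<And>z. R (T z) = T (R z)) \<Longrightarrow> R (S x) = S (R x)"
    using positive_sqrt_exists[OF pos le] by blast
  have "R = S" if R: "positive_op R" "R \<circ> R = T" for R
  proof
    fix x
    have RR: "R (R z) = S (S z)" for z
      using fun_cong[OF R(2), of z] fun_cong[OF S(2), of z] by simp
    have RS: "R (S z) = S (R z)" for z
    proof (rule comm)
      show "bounded_clinear R"
        using R(1) by (simp add: positive_op_def)
      show "R (T z) = T (R z)" for z
        by (simp flip: R(2))
    qed
    have lin: "linear R" "linear S"
      using R(1) S(1) by (auto simp: positive_op_def bounded_clinear_def clinear_imp_linear)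
    define d where "d = R x - S x"
    \<comment> \<open>\<open>(R + S) (R - S) = R\<^sup>2 - S\<^sup>2 = 0\<close>, and \<open>R\<close> and \<open>S\<close> are both positive.\<close>
    have "R d + S d = 0"
      by (simp add: d_def linear_diff lin RR RS)
    then have "inner (R d) d + inner (S d) d = 0"
      by (simp flip: inner_add_left)
    moreover have "0 \<le> inner (R d) d" "0 \<le> inner (S d) d"
      using R(1) S(1) by (auto simp: positive_op_iff)
    ultimately have "R d = 0" "S d = 0"
      using positive_op_eq_0 R(1) S(1) by (metis add_nonneg_eq_0_iff)+
    then have "inner d d = 0"
      using R(1) S(1) by (simp add: d_def positive_op_iff inner_diff_left)
    then show "R x = S x"
      by (simp add: d_def)
  qed
  then show ?thesis
    using S by blast
qed


section \<open>Extending contractions to closed ranges\<close>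

lemma clinear_diff: "clinear T \<Longrightarrow> T (x - y) = T x - T y"
  by (rule linear_diff[OF clinear_imp_linear])

lemma csubspace_range: "clinear T \<Longrightarrow> complex_module.subspace (range T)"
  unfolding clinear_iff
proof (intro complex_module.subspaceI)
  assume T: "(\<forall>x y. T (x + y) = T x + T y) \<and> (\<forall>c x. T (c *\<^sub>C x) = c *\<^sub>C T x)"
  have "T (0 + 0) = T 0 + T 0"
    using T by blast
  then have "T 0 = 0"
    by simp
  then show "0 \<in> range T"
    by (intro range_eqI[of _ _ 0]) simp
  show "x + y \<in> range T" if xy: "x \<in> range T" "y \<in> range T" for x y
  proof -
    obtain a b where "x = T a" "y = T b"
      using xy by blast
    then have "x + y = T (a + b)"
      using T by simp
    then show ?thesis
      by (rule range_eqI)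
  qed
  show "c *\<^sub>C x \<in> range T" if x: "x \<in> range T" for c x
  proof -
    obtain a where "x = T a"
      using x by blast
    then have "c *\<^sub>C x = T (c *\<^sub>C a)"
      using T by simp
    then show ?thesis
      by (rule range_eqI)
  qed
qed

lemma csubspace_closure:
  fixes M :: "'a::complex_inner set"
  assumes "complex_module.subspace M"
  shows "complex_module.subspace (closure M)"
  unfolding complex_module.subspace_def
proof (intro conjI ballI allI)
  show "0 \<in> closure M"
    using complex_module.subspace_0[OF assms] closure_subset by blast
next
  fix x y
  assume "x \<in> closure M" "y \<in> closure M"
  then obtain f g where "\<And>n. f n \<in> M" "f \<longlonglongrightarrow> x" "\<And>n. g n \<in> M" "g \<longlonglongrightarrow> y"
    by (auto simp: closure_sequential)
  then show "x + y \<in> closure M"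
    unfolding closure_sequential using complex_module.subspace_add[OF assms]
    by (intro exI[of _ "\<lambda>n. f n + g n"]) (auto intro: tendsto_add)
next
  fix c and x :: 'a
  assume "x \<in> closure M"
  then obtain f where "\<And>n. f n \<in> M" "f \<longlonglongrightarrow> x"
    by (auto simp: closure_sequential)
  then show "c *\<^sub>C x \<in> closure M"
    unfolding closure_sequential using complex_module.subspace_scale[OF assms]
    by (intro exI[of _ "\<lambda>n. c *\<^sub>C f n"]) (auto intro: scaleC.tendsto)
qed

text \<open>The closure of the graph of the map \<open>S h \<mapsto> T h\<close>, which is a well-defined contraction when
  \<open>\<parallel>T h\<parallel> \<le> \<parallel>S h\<parallel>\<close>.\<close>

definition graph_closure ::
  "('a \<Rightarrow> 'b::chilbert_space) \<Rightarrow> ('a \<Rightarrow> 'c::chilbert_space) \<Rightarrow> 'b \<Rightarrow> 'c \<Rightarrow> bool"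
  where "graph_closure S T x y \<longleftrightarrow>
    (\<exists>h. (\<lambda>n::nat. S (h n)) \<longlonglongrightarrow> x \<and> (\<lambda>n. T (h n)) \<longlonglongrightarrow> y)"

context
  fixes S :: "'a::complex_inner \<Rightarrow> 'b::chilbert_space"
    and T :: "'a \<Rightarrow> 'c::chilbert_space"
  assumes S: "clinear S" and T: "clinear T" and le: "\<And>h. norm (T h) \<le> norm (S h)"
begin

lemma graph_closure_base: "graph_closure S T (S h) (T h)"
  unfolding graph_closure_def by (intro exI[of _ "\<lambda>_. h"]) simp

lemma graph_closure_add:
  assumes "graph_closure S T x y" and "graph_closure S T x' y'"
  shows "graph_closure S T (x + x') (y + y')"
proof -
  obtain h h' where "(\<lambda>n::nat. S (h n)) \<longlonglongrightarrow> x" "(\<lambda>n. T (h n)) \<longlonglongrightarrow> y"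
    "(\<lambda>n::nat. S (h' n)) \<longlonglongrightarrow> x'" "(\<lambda>n. T (h' n)) \<longlonglongrightarrow> y'"
    using assms by (auto simp: graph_closure_def)
  then show ?thesis
    unfolding graph_closure_def using S T
    by (intro exI[of _ "\<lambda>n. h n + h' n"]) (simp add: clinear_iff tendsto_add)
qed

lemma graph_closure_scaleC:
  assumes "graph_closure S T x y"
  shows "graph_closure S T (c *\<^sub>C x) (c *\<^sub>C y)"
proof -
  obtain h where "(\<lambda>n::nat. S (h n)) \<longlonglongrightarrow> x" "(\<lambda>n. T (h n)) \<longlonglongrightarrow> y"
    using assms by (auto simp: graph_closure_def)
  then show ?thesis
    unfolding graph_closure_def using S T
    by (intro exI[of _ "\<lambda>n. c *\<^sub>C h n"]) (auto simp: clinear_iff intro: scaleC.tendsto)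
qed

lemma graph_closure_norm_le:
  assumes "graph_closure S T x y"
  shows "norm y \<le> norm x"
proof -
  obtain h where "(\<lambda>n::nat. S (h n)) \<longlonglongrightarrow> x" "(\<lambda>n. T (h n)) \<longlonglongrightarrow> y"
    using assms by (auto simp: graph_closure_def)
  then show ?thesis
    using le by (intro LIMSEQ_le[OF tendsto_norm tendsto_norm]) auto
qed

lemma graph_closure_unique:
  assumes "graph_closure S T x y" and "graph_closure S T x z"
  shows "y = z"
proof -
  have "graph_closure S T (x + (-1) *\<^sub>C x) (y + (-1) *\<^sub>C z)"
    by (intro graph_closure_add graph_closure_scaleC assms)
  from graph_closure_norm_le[OF this] show ?thesis
    by simp
qed

lemma graph_closure_total:
  assumes "x \<in> closure (range S)"
  shows "\<exists>y\<in>closure (range T). graph_closure S T x y"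
proof -
  obtain h where h: "(\<lambda>n::nat. S (h n)) \<longlonglongrightarrow> x"
  proof -
    obtain f where f: "\<And>n. f n \<in> range S" "f \<longlonglongrightarrow> x"
      using assms by (auto simp: closure_sequential)
    then have "\<forall>n. \<exists>u. f n = S u"
      by blast
    then obtain h where "\<And>n. f n = S (h n)"
      by metis
    then have "f = (\<lambda>n. S (h n))"
      by blast
    with f(2) show ?thesis
      using that by blast
  qed
  have "Cauchy (\<lambda>n. T (h n))"
  proof (rule CauchyI)
    fix e :: real
    assume "e > 0"
    from CauchyD[OF LIMSEQ_imp_Cauchy[OF h] this] obtain N where
      N: "\<And>k n. k \<ge> N \<Longrightarrow> n \<ge> N \<Longrightarrow> norm (S (h k) - S (h n)) < e"
      by auto
    have "norm (T (h k) - T (h n)) \<le> norm (S (h k) - S (h n))" for k n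
      using le[of "h k - h n"] by (simp add: clinear_diff[OF S] clinear_diff[OF T])
    then show "\<exists>N. \<forall>k\<ge>N. \<forall>n\<ge>N. norm (T (h k) - T (h n)) < e"
      using N by (meson le_less_trans)
  qed
  then obtain y where y: "(\<lambda>n. T (h n)) \<longlonglongrightarrow> y"
    by (auto simp: Cauchy_convergent_iff convergent_def)
  then have "y \<in> closure (range T)"
    unfolding closure_sequential by (intro exI[of _ "\<lambda>n. T (h n)"]) simp
  then show ?thesis
    using h y by (auto simp: graph_closure_def)
qed

lemma contraction_extension_ex1:
  "\<exists>!C. C \<in> closure (range S) \<rightarrow>\<^sub>E closure (range T) \<and>
    (\<forall>x\<in>closure (range S). \<forall>y\<in>closure (range S). C (x + y) = C x + C y) \<and>
    (\<forall>c. \<forall>x\<in>closure (range S). C (c *\<^sub>C x) = c *\<^sub>C C x) \<and>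
    (\<forall>x\<in>closure (range S). norm (C x) \<le> norm x) \<and>
    (\<forall>h. C (S h) = T h)"
  (is "\<exists>!C. ?ext C")
proof -
  let ?M = "closure (range S)"
  have sub: "complex_module.subspace ?M"
    by (intro csubspace_closure csubspace_range S)
  have "\<forall>x\<in>?M. \<exists>y. y \<in> closure (range T) \<and> graph_closure S T x y"
    using graph_closure_total by blast
  then obtain D where D: "\<And>x. x \<in> ?M \<Longrightarrow> D x \<in> closure (range T) \<and> graph_closure S T x (D x)"
    by metis
  have S_in: "S h \<in> ?M" for h
    by (rule subsetD[OF closure_subset rangeI])
  have D_eq: "D x = y" if "x \<in> ?M" "graph_closure S T x y" for x y
    using D[OF that(1)] that(2) by (metis graph_closure_unique)
  have ext: "?ext (restrict D ?M)"
  proof (intro conjI ballI allI)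
    fix x y assume xy: "x \<in> ?M" "y \<in> ?M"
    then have "x + y \<in> ?M"
      by (rule complex_module.subspace_add[OF sub])
    moreover from this have "D (x + y) = D x + D y"
      by (intro D_eq graph_closure_add) (use D xy in auto)
    ultimately show "restrict D ?M (x + y) = restrict D ?M x + restrict D ?M y"
      using xy by simp
  next
    fix c x assume x: "x \<in> ?M"
    then have "c *\<^sub>C x \<in> ?M"
      by (rule complex_module.subspace_scale[OF sub])
    moreover from this have "D (c *\<^sub>C x) = c *\<^sub>C D x"
      by (intro D_eq graph_closure_scaleC) (use D x in auto)
    ultimately show "restrict D ?M (c *\<^sub>C x) = c *\<^sub>C restrict D ?M x"
      using x by simp
  next
    fix h show "restrict D ?M (S h) = T h"
      using D_eq[OF S_in graph_closure_base] S_in by simp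
  next
    show "restrict D ?M \<in> ?M \<rightarrow>\<^sub>E closure (range T)"
      using D by auto
  next
    fix x assume "x \<in> ?M"
    then show "norm (restrict D ?M x) \<le> norm x"
      using D graph_closure_norm_le by simp
  qed
  have uniq: "C = C'" if C: "?ext C" and C': "?ext C'" for C C'
  proof
    fix x
    show "C x = C' x"
    proof (cases "x \<in> ?M")
      case True
      have "graph_closure S T x (F x)" if F: "?ext F" for F
      proof -
        obtain y h where h: "(\<lambda>n::nat. S (h n)) \<longlonglongrightarrow> x"
          using graph_closure_total[OF True] by (auto simp: graph_closure_def)
        have le: "norm (F x - T (h n)) \<le> norm (x - S (h n))" for n
        proof -
          have mem: "x - S (h n) \<in> ?M"
            using complex_module.subspace_diff[OF sub True S_in] .
          have "F x = F ((x - S (h n)) + S (h n))"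
            by simp
          also have "\<dots> = F (x - S (h n)) + F (S (h n))"
            using F mem S_in by blast
          also have "\<dots> = F (x - S (h n)) + T (h n)"
            using F by simp
          finally have "F x - T (h n) = F (x - S (h n))"
            by simp
          moreover have "norm (F (x - S (h n))) \<le> norm (x - S (h n))"
            using F mem by blast
          ultimately show ?thesis
            by (simp only:)
        qed
        have "(\<lambda>n. norm (x - S (h n))) \<longlonglongrightarrow> norm (x - x)"
          by (intro tendsto_intros h)
        then have "(\<lambda>n. norm (x - S (h n))) \<longlonglongrightarrow> 0"
          by (simp only: diff_self norm_zero)
        with always_eventually[OF allI[OF le]] have "(\<lambda>n. F x - T (h n)) \<longlonglongrightarrow> 0"
          by (rule Lim_null_comparison)
        from tendsto_diff[OF tendsto_const[of "F x"] this] have "(\<lambda>n. T (h n)) \<longlonglongrightarrow> F x"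
          by simp
        then show ?thesis
          using h by (auto simp: graph_closure_def)
      qed
      from this[OF C] this[OF C'] show ?thesis
        by (rule graph_closure_unique)
    next
      case False
      then show ?thesis
        using PiE_arb[OF conjunct1[OF C] False] PiE_arb[OF conjunct1[OF C'] False] by simp
    qed
  qed
  show ?thesis
  proof (rule ex1I)
    show "?ext (restrict D ?M)"
      by (rule ext)
    show "C = restrict D ?M" if "?ext C" for C
      using that ext by (rule uniq)
  qed
qed

end


section \<open>Cylinder sets\<close>

lemma space_Omega: "space (Omega m) = {x. \<forall>i. x i < m}"
  by (auto simp: Omega_def space_PiM)

lemma cyl_Nil: "cyl m [] = space (Omega m)"
  by (simp add: cyl_def)

lemma cyl_append_subset: "cyl m (w @ u) \<subseteq> cyl m w"
  by (auto simp: cyl_def nth_append)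

lemma sets_coordinate: "{x \<in> space (Omega m). x i = a} \<in> sets (Omega m)"
proof (cases "a < m")
  case True
  have "{x \<in> space (Omega m). x i \<in> {a}} \<in> sets (Omega m)"
    unfolding Omega_def using True by (intro sets_Collect_single) auto
  then show ?thesis
    by simp
next
  case False
  then have "{x \<in> space (Omega m). x i = a} = {}"
    by (auto simp: space_Omega)
  then show ?thesis
    by (simp only: sets.empty_sets)
qed

lemma sets_cyl: "cyl m w \<in> sets (Omega m)"
proof -
  have "{x \<in> space (Omega m). \<forall>i\<in>{..<length w}. x i = w ! i} \<in> sets (Omega m)"
    by (intro sets.sets_Collect_finite_All sets_coordinate finite_lessThan)
  also have "{x \<in> space (Omega m). \<forall>i\<in>{..<length w}. x i = w ! i} = cyl m w"
    by (auto simp: cyl_def)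
  finally show ?thesis .
qed

lemma finite_words: "finite (words m n)"
  using finite_lists_length_eq[OF finite_lessThan[of m], of n]
  unfolding words_def by (simp only: conj_commute)

text \<open>Words that are incomparable in the prefix order have disjoint cylinders, so the empty set is
  added to obtain a generator closed under intersection.\<close>

definition cylinders :: "nat \<Rightarrow> (nat \<Rightarrow> nat) set set"
  where "cylinders m = insert {} (cyl m ` {w. set w \<subseteq> {..<m}})"

lemma cyl_Int:
  assumes "length w \<le> length u"
  shows "cyl m w \<inter> cyl m u = (if prefix w u then cyl m u else {})"
proof (cases "prefix w u")
  case True
  then show ?thesis
    using cyl_append_subset by (auto elim!: prefixE)
next
  case False
  have "x \<notin> cyl m w \<inter> cyl m u" for x
  proof
    assume "x \<in> cyl m w \<inter> cyl m u"
    then have "\<And>i. i < length w \<Longrightarrow> w ! i = u ! i"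
      using assms by (auto simp: cyl_def)
    then have "w = take (length w) u"
      using assms by (intro nth_equalityI) auto
    then show False
      using False by (metis take_is_prefix)
  qed
  then show ?thesis
    using False by auto
qed

lemma Int_stable_cylinders: "Int_stable (cylinders m)"
proof -
  have "cyl m w \<inter> cyl m u \<in> cylinders m" if "set w \<subseteq> {..<m}" "set u \<subseteq> {..<m}" for w u
  proof (cases "length w \<le> length u")
    case True
    then show ?thesis
      using that by (auto simp: cyl_Int cylinders_def)
  next
    case False
    then show ?thesis
      using that by (subst Int_commute) (auto simp: cyl_Int cylinders_def)
  qed
  then show ?thesis
    by (auto simp: Int_stable_def cylinders_def)
qed

lemma sets_Omega_eq: "sets (Omega m) = sigma_sets (space (Omega m)) (cylinders m)"
proof
  show "sigma_sets (space (Omega m)) (cylinders m) \<subseteq> sets (Omega m)"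
    by (intro sets.sigma_sets_subset) (auto simp: cylinders_def sets_cyl)
  have sub: "cylinders m \<subseteq> Pow (space (Omega m))"
    by (auto simp: cylinders_def cyl_def)
  have "{x \<in> space (Omega m). x i \<in> A} \<in> sigma_sets (space (Omega m)) (cylinders m)" for i A
  proof -
    interpret sigma_algebra "space (Omega m)" "sigma_sets (space (Omega m)) (cylinders m)"
      by (rule sigma_algebra_sigma_sets[OF sub])
    have "{x \<in> space (Omega m). x i \<in> A} = (\<Union>w\<in>{w \<in> words m (Suc i). w ! i \<in> A}. cyl m w)"
    proof (intro equalityI subsetI)
      fix x
      assume x: "x \<in> {x \<in> space (Omega m). x i \<in> A}"
      define w where "w = map x [0..<Suc i]"
      have "w \<in> words m (Suc i)" "w ! i \<in> A" "x \<in> cyl m w"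
        using x by (auto simp: w_def words_def cyl_def space_Omega nth_append simp del: upt_Suc)
      then show "x \<in> (\<Union>w\<in>{w \<in> words m (Suc i). w ! i \<in> A}. cyl m w)"
        by blast
    qed (auto simp: words_def cyl_def)
    also have "\<dots> \<in> sigma_sets (space (Omega m)) (cylinders m)"
    proof (intro finite_UN ballI)
      show "finite {w \<in> words m (Suc i). w ! i \<in> A}"
        using finite_words by (rule finite_subset[rotated]) blast
      show "cyl m w \<in> sigma_sets (space (Omega m)) (cylinders m)"
        if "w \<in> {w \<in> words m (Suc i). w ! i \<in> A}" for w
        using that by (intro sigma_sets.Basic) (auto simp: cylinders_def words_def)
    qed
    finally show ?thesis .
  qed
  then have gen: "{x \<in> space (Omega m). x i \<in> A}
      \<in> sets (sigma (space (Omega m)) (cylinders m))" for i A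
    using sub by simp
  have "sets (Pi\<^sub>M UNIV (\<lambda>i::nat. count_space {..<m}))
      \<subseteq> sets (sigma (space (Omega m)) (cylinders m))"
    using sub gen by (intro sets_PiM_in_sets) (auto simp: space_measure_of Omega_def space_PiM)
  then show "sets (Omega m) \<subseteq> sigma_sets (space (Omega m)) (cylinders m)"
    using sub by (simp add: Omega_def)
qed


section \<open>Positive operator valued measures\<close>

lemma povm_positive: "is_povm m E \<Longrightarrow> B \<in> sets (Omega m) \<Longrightarrow> positive_op (E B)"
  unfolding is_povm_def by blast

lemma povm_space: "is_povm m E \<Longrightarrow> E (space (Omega m)) x = x"
  unfolding is_povm_def by simp

lemma povm_countably_additive:
  assumes "is_povm m E" "range A \<subseteq> sets (Omega m)" "disjoint_family A"
  shows "(\<lambda>i::nat. cinner (E (A i) x) y) sums cinner (E (\<Union>i. A i) x) y"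
  using assms unfolding is_povm_def by blast

lemma povm_empty:
  assumes "is_povm m E"
  shows "cinner (E {} x) y = 0"
proof -
  have "(\<lambda>i::nat. cinner (E {} x) y) sums cinner (E {} x) y"
    using povm_countably_additive[OF assms, of "\<lambda>_. {}"] by (simp add: disjoint_family_on_def)
  then have "(\<lambda>i::nat. cinner (E {} x) y) \<longlonglongrightarrow> 0"
    by (intro summable_LIMSEQ_zero) (rule sums_summable)
  then show ?thesis
    by (simp add: LIMSEQ_const_iff)
qed

lemma povm_Un:
  assumes "is_povm m E" "A \<in> sets (Omega m)" "B \<in> sets (Omega m)" "A \<inter> B = {}"
  shows "cinner (E (A \<union> B) x) y = cinner (E A x) y + cinner (E B x) y"
proof -
  have "range (binaryset A B) \<subseteq> sets (Omega m)"
    using assms by (auto simp: binaryset_def)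
  moreover have "disjoint_family (binaryset A B)"
    using assms by (auto simp: binaryset_def disjoint_family_on_def)
  ultimately have "(\<lambda>i. cinner (E (binaryset A B i) x) y) sums cinner (E (A \<union> B) x) y"
    using povm_countably_additive[OF assms(1), of "binaryset A B"] by (simp add: UN_binaryset_eq)
  moreover have "(\<lambda>i. cinner (E (binaryset A B i) x) y) sums (cinner (E A x) y + cinner (E B x) y)"
    using binaryset_sums[of "\<lambda>C. cinner (E C x) y"] povm_empty[OF assms(1)] by simp
  ultimately show ?thesis
    by (rule sums_unique2)
qed

lemma povm_compl:
  assumes "is_povm m E" "A \<in> sets (Omega m)"
  shows "cinner (E (space (Omega m) - A) x) y = cinner x y - cinner (E A x) y"
proof -
  have "A \<union> (space (Omega m) - A) = space (Omega m)"
    using sets.sets_into_space[OF assms(2)] by blast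
  then have "cinner (E (space (Omega m)) x) y
      = cinner (E A x) y + cinner (E (space (Omega m) - A) x) y"
    using povm_Un[OF assms(1), of A "space (Omega m) - A"] assms(2) by simp
  then show ?thesis
    by (simp add: povm_space[OF assms(1)])
qed

lemma povm_mono:
  assumes E: "is_povm m E" and "A \<subseteq> B" and A: "A \<in> sets (Omega m)" and B: "B \<in> sets (Omega m)"
  shows "inner (E A x) x \<le> inner (E B x) x"
proof -
  have "A \<union> (B - A) = B"
    using \<open>A \<subseteq> B\<close> by blast
  then have "inner (E B x) x = inner (E A x) x + inner (E (B - A) x) x"
    using povm_Un[OF E A, of "B - A" x x] A B by (simp add: inner_eq_Re_cinner)
  moreover have "0 \<le> inner (E (B - A) x) x"
    using povm_positive[OF E sets.Diff[OF B A]] unfolding positive_op_iff by blast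
  ultimately show ?thesis
    by simp
qed

lemma povm_le:
  assumes "is_povm m E" "A \<in> sets (Omega m)"
  shows "inner (E A x) x \<le> inner x x"
  using povm_mono[OF assms(1) sets.sets_into_space[OF assms(2)] assms(2) sets.top, of x]
  by (simp only: povm_space[OF assms(1)])

text \<open>Both sides are complex measures in \<open>B\<close> of the same total mass, so agreement on the generator
  of cylinders, which is closed under intersection, propagates to every Borel set.\<close>

lemma povm_compression_eqI:
  assumes E: "is_povm m E" and P: "is_povm m P"
    and V: "cinner (V h) (V k) = cinner h k"
    and cyl: "\<And>w. set w \<subseteq> {..<m} \<Longrightarrow> cinner (P (cyl m w) (V h)) (V k) = cinner (E (cyl m w) h) k"
    and "B \<in> sets (Omega m)"
  shows "cinner (P B (V h)) (V k) = cinner (E B h) k"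
proof -
  have sub: "cylinders m \<subseteq> Pow (space (Omega m))"
    by (auto simp: cylinders_def cyl_def)
  from \<open>B \<in> sets (Omega m)\<close> have "B \<in> sigma_sets (space (Omega m)) (cylinders m)"
    by (simp add: sets_Omega_eq)
  with Int_stable_cylinders sub show ?thesis
  proof (induction rule: sigma_sets_induct_disjoint)
    case (basic A)
    then show ?case
      using cyl by (auto simp: cylinders_def povm_empty[OF E] povm_empty[OF P])
  next
    case empty
    show ?case
      by (simp add: povm_empty[OF E] povm_empty[OF P])
  next
    case (compl A)
    then show ?case
      by (simp add: povm_compl[OF E] povm_compl[OF P] V flip: sets_Omega_eq)
  next
    case (union A)
    then have "range A \<subseteq> sets (Omega m)"
      by (simp add: sets_Omega_eq)
    from povm_countably_additive[OF E this union(1), of h k]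
      povm_countably_additive[OF P this union(1), of "V h" "V k"]
    show ?case
      by (simp only: union(3)) (rule sums_unique2)
  qed
qed


section \<open>Adjoints\<close>

text \<open>Call \<open>y\<close> representable if \<open>\<langle>V x, y\<rangle> = \<langle>x, z\<rangle>\<close> for some \<open>z\<close> and all \<open>x\<close>. When \<open>V\<close> is
  contractive, \<open>z\<close> depends contractively on \<open>y\<close>, so the representable vectors form a closed
  subspace. An adjoint therefore exists as soon as a total set is representable, and no appeal to
  the Riesz representation theorem is needed.\<close>

lemma csubspace_representable:
  "complex_module.subspace {y. \<exists>z. \<forall>x. cinner (V x) y = cinner x z}"
proof (intro complex_module.subspaceI)
  show "0 \<in> {y. \<exists>z. \<forall>x. cinner (V x) y = cinner x z}"
    by (auto intro: exI[of _ 0])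
next
  fix y y'
  assume "y \<in> {y. \<exists>z. \<forall>x. cinner (V x) y = cinner x z}"
    and "y' \<in> {y. \<exists>z. \<forall>x. cinner (V x) y = cinner x z}"
  then obtain z z' where "\<And>x. cinner (V x) y = cinner x z" "\<And>x. cinner (V x) y' = cinner x z'"
    by auto
  then have "\<forall>x. cinner (V x) (y + y') = cinner x (z + z')"
    by (simp add: cinner_add_right)
  then show "y + y' \<in> {y. \<exists>z. \<forall>x. cinner (V x) y = cinner x z}"
    by blast
next
  fix c y
  assume "y \<in> {y. \<exists>z. \<forall>x. cinner (V x) y = cinner x z}"
  then obtain z where "\<And>x. cinner (V x) y = cinner x z"
    by auto
  then have "\<forall>x. cinner (V x) (c *\<^sub>C y) = cinner x (c *\<^sub>C z)"
    by (simp add: cinner_scaleC_right)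
  then show "c *\<^sub>C y \<in> {y. \<exists>z. \<forall>x. cinner (V x) y = cinner x z}"
    by blast
qed

lemma closed_representable:
  fixes V :: "'a::chilbert_space \<Rightarrow> 'b::complex_inner"
  assumes contr: "\<And>x. norm (V x) \<le> norm x"
  shows "closed {y. \<exists>z. \<forall>x. cinner (V x) y = cinner x z}"
  unfolding closed_sequential_limits
proof (intro allI impI)
  fix f y
  assume "(\<forall>n. f n \<in> {y. \<exists>z. \<forall>x. cinner (V x) y = cinner x z}) \<and> f \<longlonglongrightarrow> y"
  then have "\<forall>n. \<exists>z. \<forall>x. cinner (V x) (f n) = cinner x z" and lim: "f \<longlonglongrightarrow> y"
    by auto
  then obtain g where g: "\<And>n x. cinner (V x) (f n) = cinner x (g n)"
    by metis
  have le: "norm (g n - g k) \<le> norm (f n - f k)" for n k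
  proof (cases "g n = g k")
    case False
    let ?u = "g n - g k"
    have "(norm ?u)\<^sup>2 = cmod (cinner ?u ?u)"
      by (simp add: cinner_self norm_power)
    also have "\<dots> = cmod (cinner (V ?u) (f n - f k))"
      by (simp add: cinner.diff_right[of "V _"] g) (simp add: cinner.diff_right)
    also have "\<dots> \<le> norm (V ?u) * norm (f n - f k)"
      by (rule cmod_cinner_le)
    also have "\<dots> \<le> norm ?u * norm (f n - f k)"
      by (intro mult_right_mono contr norm_ge_zero)
    finally show ?thesis
      using False by (simp add: power2_eq_square)
  qed simp
  have "Cauchy g"
  proof (rule CauchyI)
    fix e :: real
    assume "e > 0"
    from CauchyD[OF LIMSEQ_imp_Cauchy[OF lim] this] show "\<exists>N. \<forall>n\<ge>N. \<forall>k\<ge>N. norm (g n - g k) < e"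
      using le by (meson le_less_trans)
  qed
  then obtain z where z: "g \<longlonglongrightarrow> z"
    by (auto simp: Cauchy_convergent_iff convergent_def)
  have "cinner (V x) y = cinner x z" for x
  proof (rule LIMSEQ_unique)
    show "(\<lambda>n. cinner (V x) (f n)) \<longlonglongrightarrow> cinner (V x) y"
      by (intro cinner.tendsto tendsto_const lim)
    show "(\<lambda>n. cinner (V x) (f n)) \<longlonglongrightarrow> cinner x z"
      unfolding g by (intro cinner.tendsto tendsto_const z)
  qed
  then show "y \<in> {y. \<exists>z. \<forall>x. cinner (V x) y = cinner x z}"
    by blast
qed

lemma cspan_subset: "G \<subseteq> M \<Longrightarrow> complex_module.subspace M \<Longrightarrow> cspan G \<subseteq> M"
  unfolding cspan_def by (rule complex_module.span_minimal)

lemma csubspace_cspan: "complex_module.subspace (cspan G)"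
  unfolding cspan_def by (rule complex_module.subspace_span)

lemma cspan_superset: "G \<subseteq> cspan G"
  unfolding cspan_def by (rule complex_module.span_superset)

lemma cadjoint_eqI:
  fixes V :: "'a::chilbert_space \<Rightarrow> 'b::complex_inner"
  assumes contr: "\<And>x. norm (V x) \<le> norm x"
    and dense: "closure (cspan G) = UNIV"
    and G: "\<And>g. g \<in> G \<Longrightarrow> \<exists>z. \<forall>x. cinner (V x) g = cinner x z"
    and y: "\<And>x. cinner (V x) y = cinner x z"
  shows "cadjoint V y = z"
proof -
  let ?R = "{y. \<exists>z. \<forall>x. cinner (V x) y = cinner x z}"
  have "cspan G \<subseteq> ?R"
    using G by (intro cspan_subset csubspace_representable) blast
  then have "closure (cspan G) \<subseteq> ?R"
    using contr by (intro closure_minimal closed_representable)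
  then have "\<forall>y. \<exists>z. \<forall>x. cinner (V x) y = cinner x z"
    unfolding dense by blast
  then obtain S where S: "\<And>x y. cinner (V x) y = cinner x (S y)"
    by metis
  have "cadjoint V = S"
    unfolding cadjoint_def
  proof (rule the_equality)
    show "\<forall>x y. cinner (V x) y = cinner x (S y)"
      using S by blast
    fix S'
    assume S': "\<forall>x y. cinner (V x) y = cinner x (S' y)"
    show "S' = S"
    proof
      show "S' y = S y" for y
        by (rule cinner_right_ext) (metis S S')
    qed
  qed
  moreover have "S y = z"
    by (rule cinner_right_ext) (metis S y)
  ultimately show ?thesis
    by simp
qed


section \<open>The range space system\<close>

text \<open>The operator \<open>E\<^sub>w\<^bsup>1/2\<^esup>\<close>.\<close>

definition sqrt_cyl ::
  "nat \<Rightarrow> ((nat \<Rightarrow> nat) set \<Rightarrow> 'h::chilbert_space \<Rightarrow> 'h) \<Rightarrow> nat list \<Rightarrow> 'h \<Rightarrow> 'h"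
  where "sqrt_cyl m E w = op_sqrt (E (cyl m w))"

text \<open>The family \<open>(E\<^sub>w\<^bsup>1/2\<^esup> h)\<^sub>w\<close> over the words of length \<open>n\<close>, which is the image of \<open>h\<close> under the
  connecting maps from level \<open>0\<close> to level \<open>n\<close> (by \<open>level_map_level_image\<close>).\<close>

definition level_image ::
  "nat \<Rightarrow> ((nat \<Rightarrow> nat) set \<Rightarrow> 'h::chilbert_space \<Rightarrow> 'h) \<Rightarrow> nat \<Rightarrow> 'h \<Rightarrow> nat list \<Rightarrow> 'h"
  where "level_image m E n h = (\<lambda>w. if w \<in> words m n then sqrt_cyl m E w h else 0)"

text \<open>The family with the single entry \<open>y\<close> at the word \<open>w\<close>.\<close>

definition single :: "nat list \<Rightarrow> 'h::zero \<Rightarrow> nat list \<Rightarrow> 'h"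
  where "single w y = (\<lambda>u. if u = w then y else 0)"

lemma dsum_inner_single:
  assumes "w \<in> words m n"
  shows "dsum_inner m n (single w y) x = cinner y (x w)"
proof -
  have "dsum_inner m n (single w y) x = (\<Sum>u\<in>words m n. if u = w then cinner y (x w) else 0)"
    unfolding dsum_inner_def single_def by (rule sum.cong) auto
  also have "\<dots> = cinner y (x w)"
    using assms finite_words by (simp add: sum.delta')
  finally show ?thesis .
qed

context
  fixes m :: nat and E :: "(nat \<Rightarrow> nat) set \<Rightarrow> 'h::chilbert_space \<Rightarrow> 'h"
  assumes E: "is_povm m E"
begin

lemma sqrt_cyl_ex1: "\<exists>!S. positive_op S \<and> S \<circ> S = E (cyl m w)"
  by (intro positive_sqrt_ex1 povm_positive[OF E] povm_le[OF E] sets_cyl)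

lemma positive_op_sqrt_cyl: "positive_op (sqrt_cyl m E w)"
  and sqrt_cyl_square: "sqrt_cyl m E w \<circ> sqrt_cyl m E w = E (cyl m w)"
  using theI'[OF sqrt_cyl_ex1[of w]] unfolding sqrt_cyl_def op_sqrt_def by blast+

lemma clinear_sqrt_cyl: "clinear (sqrt_cyl m E w)"
  using positive_op_sqrt_cyl by (simp add: positive_op_def bounded_clinear_def)

lemma cinner_sqrt_cyl: "cinner (sqrt_cyl m E w h) (sqrt_cyl m E w k) = cinner (E (cyl m w) h) k"
  using positive_op_cinner_commute[OF positive_op_sqrt_cyl[of w], of "sqrt_cyl m E w h" k]
  by (simp flip: sqrt_cyl_square)

lemma sqrt_cyl_Nil: "sqrt_cyl m E [] = id"
proof -
  have "positive_op (id :: 'h \<Rightarrow> 'h)"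
    by (auto simp: positive_op_iff bounded_clinear_def clinear_iff intro: exI[of _ 1])
  moreover have "E (cyl m []) = id"
    by (rule ext) (simp add: cyl_Nil povm_space[OF E])
  ultimately show ?thesis
    using sqrt_cyl_ex1[of "[]"] positive_op_sqrt_cyl[of "[]"] sqrt_cyl_square[of "[]"]
    by (metis id_comp)
qed

lemma sqrt_cyl_norm_le: "norm (sqrt_cyl m E (w @ u) h) \<le> norm (sqrt_cyl m E w h)"
  using povm_mono[OF E cyl_append_subset sets_cyl sets_cyl, of w u h]
  by (simp add: norm_le inner_eq_Re_cinner cinner_sqrt_cyl)

lemma edge_contraction_sqrt_cyl:
  "edge_contraction m E w j (sqrt_cyl m E w h) = sqrt_cyl m E (w @ [j]) h"
  using theI'[OF contraction_extension_ex1
      [OF clinear_sqrt_cyl[of w] clinear_sqrt_cyl[of "w @ [j]"] sqrt_cyl_norm_le]]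
  unfolding edge_contraction_def range_space_def sqrt_cyl_def by blast

lemma range_space_eq: "range_space m E w = closure (range (sqrt_cyl m E w))"
  by (simp add: range_space_def sqrt_cyl_def)

lemma csubspace_range_space: "complex_module.subspace (range_space m E w)"
  unfolding range_space_eq by (intro csubspace_closure csubspace_range clinear_sqrt_cyl)

lemma sqrt_cyl_in_range_space: "sqrt_cyl m E w h \<in> range_space m E w"
  unfolding range_space_eq by (rule subsetD[OF closure_subset rangeI])

lemma level_spaceI:
  "(\<And>w. w \<in> words m n \<Longrightarrow> x w \<in> range_space m E w) \<Longrightarrow> (\<And>w. w \<notin> words m n \<Longrightarrow> x w = 0)
    \<Longrightarrow> x \<in> level_space m E n"
  by (simp add: level_space_def)

lemma level_space_restrict:
  "x \<in> level_space m E n \<Longrightarrow> (\<lambda>u. if u \<in> A then x u else 0) \<in> level_space m E n"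
  by (simp add: level_space_def complex_module.subspace_0[OF csubspace_range_space])

lemma level_image_in_level_space: "level_image m E n h \<in> level_space m E n"
  by (intro level_spaceI) (auto simp: level_image_def sqrt_cyl_in_range_space)

lemma single_in_level_space:
  "w \<in> words m n \<Longrightarrow> y \<in> range_space m E w \<Longrightarrow> single w y \<in> level_space m E n"
  by (intro level_spaceI)
    (auto simp: single_def complex_module.subspace_0[OF csubspace_range_space])

lemma level_map_level_image: "level_map m E n (level_image m E n h) = level_image m E (Suc n) h"
proof
  fix u
  show "level_map m E n (level_image m E n h) u = level_image m E (Suc n) h u"
  proof (cases "u \<in> words m (Suc n)")
    case True
    then have "u \<noteq> []" and "butlast u \<in> words m n"
      by (auto simp: words_def dest: in_set_butlastD)
    then show ?thesis
      using True
      by (simp add: level_map_def level_image_def edge_contraction_sqrt_cyl)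
  next
    case False
    then show ?thesis
      by (simp add: level_map_def level_image_def)
  qed
qed

text \<open>The orthogonal projection cuts a family down to the extensions of \<open>w\<close>; the condition in the
  definition of \<open>level_proj\<close> determines it because \<open>dsum_inner\<close> is definite on level spaces.\<close>

lemma level_proj_eq:
  assumes x: "x \<in> level_space m E n"
  shows "level_proj m E n w x = (\<lambda>u. if prefix w u then x u else 0)"
  unfolding level_proj_def
proof (rule the_equality)
  let ?y = "\<lambda>u. if prefix w u then x u else 0"
  have y: "?y \<in> level_subspace m E n w"
    using level_space_restrict[OF x, of "{u. prefix w u}"] by (simp add: level_subspace_def)
  have orth: "\<forall>z\<in>level_subspace m E n w. dsum_inner m n (\<lambda>u. x u - ?y u) z = 0"
    unfolding dsum_inner_def by (auto simp: level_subspace_def intro!: sum.neutral)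
  show "?y \<in> level_subspace m E n w \<and>
      (\<forall>z\<in>level_subspace m E n w. dsum_inner m n (\<lambda>u. x u - ?y u) z = 0)"
    using y orth by blast
  fix y'
  assume y': "y' \<in> level_subspace m E n w \<and>
      (\<forall>z\<in>level_subspace m E n w. dsum_inner m n (\<lambda>u. x u - y' u) z = 0)"
  define d where "d u = ?y u - y' u" for u
  have d: "d \<in> level_subspace m E n w"
    using y y' complex_module.subspace_diff[OF csubspace_range_space]
    unfolding level_subspace_def level_space_def d_def by simp
  have "dsum_inner m n d d
      = dsum_inner m n (\<lambda>u. x u - y' u) d - dsum_inner m n (\<lambda>u. x u - ?y u) d"
    unfolding dsum_inner_def by (simp add: d_def cinner.diff_left flip: sum_subtractf)
  also have "\<dots> = 0"
    using d y' orth by simp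
  finally have "complex_of_real (\<Sum>u\<in>words m n. (norm (d u))\<^sup>2) = 0"
    by (simp add: dsum_inner_def cinner_self)
  then have "\<forall>u\<in>words m n. d u = 0"
    by (simp only: of_real_eq_0_iff) (simp add: sum_nonneg_eq_0_iff finite_words)
  moreover have "d u = 0" if "u \<notin> words m n" for u
    using d that by (simp add: level_subspace_def level_space_def)
  ultimately have "?y u = y' u" for u
    unfolding d_def by (metis eq_iff_diff_eq_0)
  then show "y' = ?y"
    by (intro ext) simp
qed

lemma level_proj_level_image:
  assumes "w \<in> words m n"
  shows "level_proj m E n w (level_image m E n h) = single w (sqrt_cyl m E w h)"
proof -
  have "prefix w u \<longleftrightarrow> u = w" if "u \<in> words m n" for u
    using assms that by (auto simp: words_def prefix_def)
  then show ?thesis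
    unfolding level_proj_eq[OF level_image_in_level_space] using assms
    by (auto simp: level_image_def single_def)
qed

end


section \<open>The direct limit\<close>

context
  fixes m :: nat and E :: "(nat \<Rightarrow> nat) set \<Rightarrow> 'h::chilbert_space \<Rightarrow> 'h"
    and U :: "nat \<Rightarrow> (nat list \<Rightarrow> 'h) \<Rightarrow> 'k::chilbert_space"
  assumes E: "is_povm m E" and U: "is_direct_limit m E U"
begin

lemma U_add: "x \<in> level_space m E n \<Longrightarrow> y \<in> level_space m E n \<Longrightarrow>
    U n (\<lambda>w. x w + y w) = U n x + U n y"
  and U_scaleC: "x \<in> level_space m E n \<Longrightarrow> U n (\<lambda>w. c *\<^sub>C x w) = c *\<^sub>C U n x"
  and U_cinner: "x \<in> level_space m E n \<Longrightarrow> y \<in> level_space m E n \<Longrightarrow>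
    cinner (U n x) (U n y) = dsum_inner m n x y"
  and U_level_map: "x \<in> level_space m E n \<Longrightarrow> U (Suc n) (level_map m E n x) = U n x"
  and U_dense: "closure (\<Union>n. U n ` level_space m E n) = UNIV"
  using U unfolding is_direct_limit_def by blast+

lemma U_level_image: "U n (level_image m E n h) = canonical_isometry U h"
proof (induction n)
  case 0
  have "level_image m E 0 h = (\<lambda>w. if w = [] then h else 0)"
    by (auto simp: level_image_def words_def sqrt_cyl_Nil[OF E])
  then show ?case
    by (simp add: canonical_isometry_def)
next
  case (Suc n)
  then show ?case
    using U_level_map[OF level_image_in_level_space[OF E, of n h]]
    by (simp add: level_map_level_image[OF E])
qed

lemma canonical_isometry_eq: "canonical_isometry U h = U 0 (single [] h)"
  by (simp add: canonical_isometry_def single_def)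

lemma Nil_in_words: "[] \<in> words m 0"
  by (simp add: words_def)

lemma single_Nil_in_level_space: "single [] h \<in> level_space m E 0"
  using sqrt_cyl_in_range_space[OF E, of "[]" h]
  by (intro single_in_level_space[OF E] Nil_in_words) (simp add: sqrt_cyl_Nil[OF E])

lemma canonical_isometry_cinner:
  "cinner (canonical_isometry U h) (canonical_isometry U k) = cinner h k"
  unfolding canonical_isometry_eq
  by (simp add: U_cinner single_Nil_in_level_space dsum_inner_single[OF Nil_in_words])
    (simp add: single_def)

lemma cisometry_canonical_isometry: "cisometry (canonical_isometry U)"
proof -
  have "single [] (x + y) = (\<lambda>w. single [] x w + single [] y w)" for x y :: 'h
    by (auto simp: single_def)
  moreover have "single [] (c *\<^sub>C x) = (\<lambda>w. c *\<^sub>C single [] x w)" for c and x :: 'h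
    by (auto simp: single_def)
  ultimately have "clinear (canonical_isometry U)"
    by (simp add: clinear_iff canonical_isometry_eq U_add U_scaleC single_Nil_in_level_space)
  moreover have "norm (canonical_isometry U x) = norm x" for x
    by (simp add: norm_eq_sqrt_inner inner_eq_Re_cinner canonical_isometry_cinner)
  ultimately show ?thesis
    by (simp add: cisometry_def)
qed

lemma U_single_dist:
  assumes w: "w \<in> words m n" and "y \<in> range_space m E w" "z \<in> range_space m E w"
  shows "norm (U n (single w y) - U n (single w z)) = norm (y - z)"
proof -
  let ?d = "single w (y - z)"
  have d: "?d \<in> level_space m E n"
    using assms complex_module.subspace_diff[OF csubspace_range_space[OF E]]
    by (intro single_in_level_space[OF E])
  have "single w y = (\<lambda>u. ?d u + single w z u)"
    by (auto simp: single_def)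
  then have "U n (single w y) = U n ?d + U n (single w z)"
    using U_add[OF d single_in_level_space[OF E w assms(3)]] by simp
  then have "norm (U n (single w y) - U n (single w z)) = norm (U n ?d)"
    by simp
  also have "\<dots> = norm (y - z)"
    unfolding norm_eq_sqrt_inner inner_eq_Re_cinner U_cinner[OF d d] dsum_inner_single[OF w]
    by (simp add: single_def)
  finally show ?thesis .
qed

text \<open>A closed subspace that contains, for each word \<open>w\<close>, the vectors \<open>E\<^sub>w\<^bsup>1/2\<^esup> h\<close> placed at \<open>w\<close> also
  contains the closure \<open>H\<^sub>w\<close> of their range placed at \<open>w\<close>, hence all sums over the finitely many
  words of a level.\<close>

lemma closed_csubspace_eq_UNIV:
  assumes sub: "complex_module.subspace M" and "closed M"
    and base: "\<And>w n h. w \<in> words m n \<Longrightarrow> U n (single w (sqrt_cyl m E w h)) \<in> M"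
  shows "M = UNIV"
proof -
  have single_M: "U n (single w y) \<in> M"
    if w: "w \<in> words m n" and y: "y \<in> range_space m E w" for n w y
  proof -
    obtain f where f: "\<And>i::nat. f i \<in> range (sqrt_cyl m E w)" "f \<longlonglongrightarrow> y"
      using y by (auto simp: range_space_eq[OF E] closure_sequential)
    have f_in: "f i \<in> range_space m E w" for i
      using f(1)[of i] sqrt_cyl_in_range_space[OF E] by auto
    have "(\<lambda>i. norm (f i - y)) \<longlonglongrightarrow> 0"
      using f(2) by (simp add: LIM_zero_iff tendsto_norm_zero_iff)
    then have "(\<lambda>i. norm (U n (single w (f i)) - U n (single w y))) \<longlonglongrightarrow> 0"
      using U_single_dist[OF w f_in y] by simp
    then have lim: "(\<lambda>i. U n (single w (f i))) \<longlonglongrightarrow> U n (single w y)"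
      by (simp only: tendsto_norm_zero_iff LIM_zero_iff)
    have "U n (single w (f i)) \<in> M" for i
      using f(1)[of i] base[OF w] by auto
    then show ?thesis
      by (rule closed_sequentially[OF \<open>closed M\<close> _ lim])
  qed
  have "U n x \<in> M" if x: "x \<in> level_space m E n" for n x
  proof -
    have "U n (\<lambda>u. if u \<in> F then x u else 0) \<in> M" if "finite F" "F \<subseteq> words m n" for F
      using that
    proof (induction F)
      case empty
      have "U n (\<lambda>u. 0 *\<^sub>C x u) = 0 *\<^sub>C U n x"
        by (rule U_scaleC[OF x])
      then show ?case
        by (simp add: complex_module.subspace_0[OF sub])
    next
      case (insert w F)
      then have w: "w \<in> words m n" and xw: "x w \<in> range_space m E w"
        using x by (auto simp: level_space_def)
      have "(\<lambda>u. if u \<in> insert w F then x u else 0)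
          = (\<lambda>u. single w (x w) u + (if u \<in> F then x u else 0))"
        using insert.hyps by (auto simp: single_def)
      then have "U n (\<lambda>u. if u \<in> insert w F then x u else 0)
          = U n (single w (x w)) + U n (\<lambda>u. if u \<in> F then x u else 0)"
        using U_add[OF single_in_level_space[OF E w xw] level_space_restrict[OF E x, of F]]
        by simp
      then show ?case
        using complex_module.subspace_add[OF sub single_M[OF w xw]] insert by simp
    qed
    from this[OF finite_words subset_refl]
    have "U n (\<lambda>u. if u \<in> words m n then x u else 0) \<in> M" .
    moreover have "(\<lambda>u. if u \<in> words m n then x u else 0) = x"
      using x by (auto simp: level_space_def)
    ultimately show ?thesis
      by simp
  qed
  then have "closure (\<Union>n. U n ` level_space m E n) \<subseteq> M"
    using \<open>closed M\<close> by (intro closure_minimal) auto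
  then show ?thesis
    unfolding U_dense by blast
qed

end


section \<open>The dilation\<close>

theorem theorem3p4:
  fixes m :: nat
    and E :: "(nat \<Rightarrow> nat) set \<Rightarrow> 'h::chilbert_space \<Rightarrow> 'h"
    and U :: "nat \<Rightarrow> (nat list \<Rightarrow> 'h) \<Rightarrow> 'k::chilbert_space"
    and P :: "(nat \<Rightarrow> nat) set \<Rightarrow> 'k \<Rightarrow> 'k"
  assumes "m \<ge> 2"
    and "is_povm m E"
    and "is_direct_limit m E U"
    and "is_canonical_pvm m E U P"
  shows "minimal_naimark_dilation m E P (canonical_isometry U)"
proof -
  note E = assms(2) and U = assms(3)
  let ?V = "canonical_isometry U"
  let ?G = "{P B (?V h) | B h. B \<in> sets (Omega m)}"
  have P: "P (cyl m w) (U n x) = U n (level_proj m E n w x)"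
    if "set w \<subseteq> {..<m}" "length w \<le> n" "x \<in> level_space m E n" for w n x
    using assms(4) that unfolding is_canonical_pvm_def by blast
  have pvm: "is_pvm m P"
    using assms(4) unfolding is_canonical_pvm_def by blast
  then have Pp: "is_povm m P"
    unfolding is_pvm_def by blast
  have PV: "P (cyl m w) (?V h) = U n (single w (sqrt_cyl m E w h))" if w: "w \<in> words m n" for w n h
  proof -
    have "P (cyl m w) (U n (level_image m E n h)) = U n (level_proj m E n w (level_image m E n h))"
      using w by (intro P level_image_in_level_space[OF E]) (auto simp: words_def)
    then show ?thesis
      by (simp only: U_level_image[OF E U] level_proj_level_image[OF E w])
  qed
  have comp_cyl: "cinner (P (cyl m w) (?V h)) (?V k) = cinner (E (cyl m w) h) k"
    if "set w \<subseteq> {..<m}" for w h k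
  proof -
    define n where "n = length w"
    have w: "w \<in> words m n"
      using that by (simp add: words_def n_def)
    have "cinner (P (cyl m w) (?V h)) (?V k)
        = cinner (U n (single w (sqrt_cyl m E w h))) (U n (level_image m E n k))"
      by (simp only: PV[OF w] U_level_image[OF E U])
    also have "\<dots> = dsum_inner m n (single w (sqrt_cyl m E w h)) (level_image m E n k)"
      by (intro U_cinner[OF E U] single_in_level_space[OF E w] sqrt_cyl_in_range_space[OF E]
          level_image_in_level_space[OF E])
    also have "\<dots> = cinner (sqrt_cyl m E w h) (sqrt_cyl m E w k)"
      using w by (simp add: dsum_inner_single level_image_def)
    finally show ?thesis
      by (simp add: cinner_sqrt_cyl[OF E])
  qed
  have comp: "cinner (P B (?V h)) (?V k) = cinner (E B h) k" if "B \<in> sets (Omega m)" for B h k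
    using E Pp canonical_isometry_cinner[OF E U] comp_cyl that by (rule povm_compression_eqI)
  have dense: "closure (cspan ?G) = UNIV"
  proof (rule closed_csubspace_eq_UNIV[OF E U])
    show "complex_module.subspace (closure (cspan ?G))"
      by (intro csubspace_closure csubspace_cspan)
    show "U n (single w (sqrt_cyl m E w h)) \<in> closure (cspan ?G)" if w: "w \<in> words m n" for w n h
    proof -
      have "P (cyl m w) (?V h) \<in> ?G"
        using sets_cyl by blast
      then show ?thesis
        unfolding PV[OF w] by (intro subsetD[OF closure_subset] subsetD[OF cspan_superset])
    qed
  qed simp
  have rep: "cinner (?V k) (P B (?V h)) = cinner k (E B h)" if "B \<in> sets (Omega m)" for B h k
    using comp[OF that, of h k] by (metis cinner_commute)
  have "E B = cadjoint ?V \<circ> P B \<circ> ?V" if B: "B \<in> sets (Omega m)" for B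
  proof
    fix h
    have "cadjoint ?V (P B (?V h)) = E B h"
    proof (rule cadjoint_eqI[OF _ dense])
      show "norm (?V x) \<le> norm x" for x
        using cisometry_canonical_isometry[OF E U] by (simp add: cisometry_def)
      show "\<exists>z. \<forall>x. cinner (?V x) g = cinner x z" if "g \<in> ?G" for g
        using that rep by blast
      show "cinner (?V x) (P B (?V h)) = cinner x (E B h)" for x
        by (rule rep[OF B])
    qed
    then show "E B h = (cadjoint ?V \<circ> P B \<circ> ?V) h"
      by simp
  qed
  then show ?thesis
    unfolding minimal_naimark_dilation_def
    using pvm cisometry_canonical_isometry[OF E U] dense by blast
qed

end
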